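(* Let $P_1$ and $P_2$ be two probability measures on $\mathbb{R}^d$ with pdfs $p_1$ and $p_2$ having nested supports $\Omega_{p_2}\subseteq\Omega_{p_1}$. Assume that $\mathbb{E}_{p_1}|h|<\infty$ for every $h\in\mathrm{Lip}(\Omega_{p_1},1)$. Let $\mathbf{F}_i\in\mathcal{F}_{\mathrm{loc}}(p_i)$, $i=1,2$, be $d\times d$ matrix-valued functions and let $$\mathcal{A}_i g=\langle \mathcal{T}_{\mathrm{div},p_i}\mathbf{F}_i,\nabla g\rangle+\langle \mathbf{F}_i,\nabla^2 g\rangle_{\mathrm{HS}},\qquad i=1,2,$$ with corresponding Stein classes $\mathcal{F}(\mathcal{A}_i)$. Let $\mathcal{G}_2(\mathbf{F}_1,\mathbf{F}_2)\subseteq\mathcal{F}(\mathcal{A}_1)$ be a collection of functions such that for all $g\in\mathcal{G}_2(\mathbf{F}_1,\mathbf{F}_2)$: (i) $\mathbb{E}_{p_2}|\mathcal{A}_i g|<\infty$ for $i=1,2$; (ii) $\int_{\Omega_{p_2}}|\mathrm{div}(\mathbf{F}_2^T\nabla g\,p_2)|<\infty$. Suppose that for every $h\in\mathrm{Lip}(\Omega_{p_1},1)$ there is a solution $g\in\mathcal{G}_2(\mathbf{F}_1,\mathbf{F}_2)$ of the Stein equation $$\langle \mathcal{T}_{\mathrm{div},p_1}\mathbf{F}_1,\nabla g\rangle+\langle \mathbf{F}_1,\nabla^2 g\rangle_{\mathrm{HS}}=h-\mathbb{E}_{p_1}h .$$ Then $$\mathcal{W}_1(P_1,P_2)\le \sup_{g\in\mathcal{G}_2(\mathbf{F}_1,\mathbf{F}_2)}\Bigl|\mathbb{E}_{p_2}\bigl[\langle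 \mathcal{T}_{\mathrm{div},p_1}\mathbf{F}_1-\mathcal{T}_{\mathrm{div},p_2}\mathbf{F}_2,\nabla g\rangle+\langle\mathbf{F}_1-\mathbf{F}_2,\nabla^2 g\rangle_{\mathrm{HS}}\bigr]\Bigr|+\kappa_2(\mathbf{F}_1,\mathbf{F}_2),$$ where $$\kappa_2(\mathbf{F}_1,\mathbf{F}_2)=\sup_{g\in\mathcal{G}_2(\mathbf{F}_1,\mathbf{F}_2)}\Bigl|\int_{\Omega_{p_2}}\mathrm{div}\bigl(\mathbf{F}_2^T\nabla g\,p_2\bigr)\Bigr| .$$
   Context: Every pdf $p$ (density with respect to Lebesgue measure on $\mathbb{R}^d$) is assumed to have open support $\Omega_p=\{x: p(x)>0\}$ and to be continuous on $\Omega_p$. $\mathbb{E}_p f=\int_{\Omega_p} f p$; $L^1(p)$ is the set of functions all of whose components are integrable with respect to $p$. $S^{d-1}$ is the unit sphere, $\partial_e$ the derivative in direction $e\in S^{d-1}$, $\partial_i=\partial_{e_i}$ for the canonical basis. $\nabla^2 g$ is the Hessian; $\langle A,B\rangle_{\mathrm{HS}}=\mathrm{Tr}(A^TB)$. For an open set $\Omega$, $\mathrm{Lip}(\Omega,1)$ is the set of Lipschitz functions $\Omega\to\mathbb{R}$ with Lipschitz constant $1$, and the 1-Wasserstein distance is $\mathcal{W}_1(P_1,P_2)=\sup_{h\in\mathrm{Lip}(\Omega_{p_1},1)}|\int h\,dP_1-\int h\,dP_2|$. $\mathrm{ACL}(\Omega)$ is the set of Borel measurable $g:\Omega\to\mathbb{R}$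 such that for each $e\in S^{d-1}$ and for almost all lines $L$ parallel to $e$ (with respect to $(d-1)$-dimensional Lebesgue measure), the restriction of $g$ to any compact interval contained in $\Omega\cap L$ is absolutely continuous. $\mathrm{ACL}^1(\Omega)$: functions $g\in\mathrm{ACL}(\Omega)$ with $\partial_e g\in L^1(\Omega)$ for all $e\in S^{d-1}$. $\mathrm{ACL}^1_0(\Omega)$: functions $g\in\mathrm{ACL}^1(\Omega)$ with $\int_\Omega\partial_e g=0$ for all $e$. $\mathcal{F}(p)$ is the set of scalar-, vector- and matrix-valued functions on $\Omega_p$ all of whose components $f$ satisfy $fp\in\mathrm{ACL}^1_0(\Omega_p)$. $\mathcal{F}_{\mathrm{loc}}(p)$ is the set of those all of whose components $f$ satisfy $fp\in\mathrm{ACL}(\Omega_p)$. For $\mathbf{F}\in\mathcal{F}_{\mathrm{loc}}(p)$, $\mathrm{dom}(p,\mathbf{F})$ is the set of $g\in\mathrm{ACL}(\Omega_p)$ with $\mathbf{F}g\in\mathcal{F}(p)$ and $\mathbf{F}\,\partial_e g\in L^1(p)$ for all $e\in S^{d-1}$. The divergence of a matrix-valued function acts on rows: $(\mathrm{div}\,\mathbf{F})_i=\sum_j\partial_j f_{ij}$. The Stein divergence operator is $\mathcal{T}_{\mathrm{div},p}\mathbf{F}=\mathrm{div}(p\mathbf{F})/p$ on $\Omega_p$. The Stein class $\mathcal{F}(\mathcal{A}_i)$ of the operator $\mathcal{A}_i$ is the collection of functions $g$ such that $\nabla g\in\mathrm{dom}(p_i,\mathbf{F}_i)$ (i.e. the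 conditions defining $\mathrm{dom}(p_i,\mathbf{F}_i)$ hold for each component of $\nabla g$). *)

theory Defs
  imports "HOL-Analysis.Analysis" "HOL-Probability.Probability"
begin

section \<open>Densities\<close>

definition supp :: "(real^'n \<Rightarrow> real) \<Rightarrow> (real^'n) set"
  where "supp p = {x. p x > 0}"

definition has_pdf :: "(real^'n) measure \<Rightarrow> (real^'n \<Rightarrow> real) \<Rightarrow> bool"
  where "has_pdf P p \<longleftrightarrow>
    p \<in> borel_measurable borel \<and> (\<forall>x. 0 \<le> p x) \<and> P = density lborel (\<lambda>x. ennreal (p x)) \<and>
    open (supp p) \<and> continuous_on (supp p) p"

definition L1 :: "(real^'n \<Rightarrow> real) \<Rightarrow> (real^'n \<Rightarrow> real) set"
  where "L1 p = {f. set_integrable lebesgue (supp p) (\<lambda>x. f x * p x)}"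

definition expect :: "(real^'n \<Rightarrow> real) \<Rightarrow> (real^'n \<Rightarrow> real) \<Rightarrow> real"
  where "expect p f = (LINT x:supp p|lebesgue. f x * p x)"


section \<open>The Wasserstein distance\<close>

text \<open>A function on an open set \<open>\<Omega>\<close> is represented by a total function whose values outside
  \<open>\<Omega>\<close> are irrelevant. This is why the integrals below are restricted to \<open>\<Omega>\<close>, which is meant to
  carry both measures.\<close>

definition Lip1 :: "(real^'n) set \<Rightarrow> (real^'n \<Rightarrow> real) set"
  where "Lip1 \<Omega> = {h. 1-lipschitz_on \<Omega> h}"

definition wasserstein1 :: "(real^'n) set \<Rightarrow> (real^'n) measure \<Rightarrow> (real^'n) measure \<Rightarrow> ennreal"
  where "wasserstein1 \<Omega> P1 P2 =
    (SUP h\<in>Lip1 \<Omega>. ennreal \<bar>(LINT x:\<Omega>|P1. h x) - (LINT x:\<Omega>|P2. h x)\<bar>)"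


section \<open>Derivatives\<close>

text \<open>At points where the derivative does not exist, \<^const>\<open>deriv\<close> has an unspecified value.
  For \<open>g\<close> in \<open>ACL \<Omega>\<close> (below) this concerns only a null set of points of \<open>\<Omega>\<close>.\<close>

definition dir_deriv :: "real^'n \<Rightarrow> (real^'n \<Rightarrow> real) \<Rightarrow> real^'n \<Rightarrow> real"
  where "dir_deriv e g x = deriv (\<lambda>t. g (x + t *\<^sub>R e)) 0"

definition pderiv_exists :: "'n \<Rightarrow> (real^'n \<Rightarrow> real) \<Rightarrow> real^'n \<Rightarrow> bool"
  where "pderiv_exists i g x \<longleftrightarrow> (\<lambda>t. g (x + t *\<^sub>R axis i 1)) field_differentiable (at 0)"

definition partial :: "'n \<Rightarrow> (real^'n \<Rightarrow> real) \<Rightarrow> real^'n \<Rightarrow> real"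
  where "partial i = dir_deriv (axis i 1)"

definition grad :: "(real^'n \<Rightarrow> real) \<Rightarrow> real^'n \<Rightarrow> real^'n"
  where "grad g x = (\<chi> i. partial i g x)"

text \<open>The Hessian is the Jacobian matrix of the gradient: row \<open>i\<close> is the gradient of the
  \<open>i\<close>-th partial derivative.\<close>

definition hess :: "(real^'n \<Rightarrow> real) \<Rightarrow> real^'n \<Rightarrow> real^'n^'n"
  where "hess g x = (\<chi> i j. partial j (partial i g) x)"

definition div_vec :: "(real^'n \<Rightarrow> real^'n) \<Rightarrow> real^'n \<Rightarrow> real"
  where "div_vec v x = (\<Sum>j\<in>UNIV. partial j (\<lambda>y. v y $ j) x)"

definition div_mat :: "(real^'n \<Rightarrow> real^'n^'n) \<Rightarrow> real^'n \<Rightarrow> real^'n"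
  where "div_mat F x = (\<chi> i. div_vec (\<lambda>y. F y $ i) x)"

definition hs_inner :: "real^'n^'n \<Rightarrow> real^'n^'n \<Rightarrow> real"
  where "hs_inner A B = trace (transpose A ** B)"


section \<open>Absolute continuity on lines\<close>

definition abs_continuous_on :: "real \<Rightarrow> real \<Rightarrow> (real \<Rightarrow> real) \<Rightarrow> bool"
  where "abs_continuous_on a b f \<longleftrightarrow>
    (\<forall>\<epsilon>>0. \<exists>\<delta>>0. \<forall>I :: (real \<times> real) set.
       finite I \<longrightarrow> (\<forall>(l, r)\<in>I. a \<le> l \<and> l \<le> r \<and> r \<le> b) \<longrightarrow>
       pairwise (\<lambda>(l, r) (l', r'). {l<..<r} \<inter> {l'<..<r'} = {}) I \<longrightarrow>
       (\<Sum>(l, r)\<in>I. r - l) < \<delta> \<longrightarrow> (\<Sum>(l, r)\<in>I. \<bar>f r - f l\<bar>) < \<epsilon>)"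

text \<open>The \<open>(d - 1)\<close>-dimensional Lebesgue measure on the hyperplane orthogonal to \<open>e\<close>, as a measure
  on the whole space. It is built from an orthonormal basis of the hyperplane exactly as
  \<^const>\<open>lborel\<close> is built from \<^const>\<open>Basis\<close>; by rotation invariance, the choice of the basis does
  not matter. Lines parallel to \<open>e\<close> are parametrised by their intersection with this hyperplane.\<close>

definition orthonormal_basis_of :: "(real^'n) set \<Rightarrow> (real^'n) set \<Rightarrow> bool"
  where "orthonormal_basis_of V B \<longleftrightarrow> pairwise orthogonal B \<and> (\<forall>b\<in>B. norm b = 1) \<and> span B = V"

definition hyperplane_basis :: "real^'n \<Rightarrow> (real^'n) set"
  where "hyperplane_basis e = (SOME B. orthonormal_basis_of {x. e \<bullet> x = 0} B)"

lemma hyperplane_basis: "orthonormal_basis_of {x. e \<bullet> x = 0} (hyperplane_basis e)"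
  unfolding hyperplane_basis_def
proof (rule someI_ex)
  obtain B where "pairwise orthogonal B" "\<And>b. b \<in> B \<Longrightarrow> norm b = 1" "span B = {x. e \<bullet> x = 0}"
    using orthonormal_basis_subspace[OF subspace_hyperplane[of e]] by metis
  then show "\<exists>B. orthonormal_basis_of {x. e \<bullet> x = 0} B"
    unfolding orthonormal_basis_of_def by blast
qed

definition hyperplane_lborel :: "real^'n \<Rightarrow> (real^'n) measure"
  where "hyperplane_lborel e =
    distr (\<Pi>\<^sub>M b\<in>hyperplane_basis e. lborel) borel (\<lambda>f. \<Sum>b\<in>hyperplane_basis e. f b *\<^sub>R b)"

definition ACL :: "(real^'n) set \<Rightarrow> (real^'n \<Rightarrow> real) set"
  where "ACL \<Omega> = {g. g \<in> borel_measurable (restrict_space borel \<Omega>) \<and>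
    (\<forall>e\<in>sphere 0 1. AE y in hyperplane_lborel e. \<forall>a b.
       a \<le> b \<and> (\<forall>t\<in>{a..b}. y + t *\<^sub>R e \<in> \<Omega>) \<longrightarrow>
       abs_continuous_on a b (\<lambda>t. g (y + t *\<^sub>R e)))}"

definition ACL1 :: "(real^'n) set \<Rightarrow> (real^'n \<Rightarrow> real) set"
  where "ACL1 \<Omega> = {g \<in> ACL \<Omega>. \<forall>e\<in>sphere 0 1. set_integrable lebesgue \<Omega> (dir_deriv e g)}"

definition ACL1_0 :: "(real^'n) set \<Rightarrow> (real^'n \<Rightarrow> real) set"
  where "ACL1_0 \<Omega> = {g \<in> ACL1 \<Omega>. \<forall>e\<in>sphere 0 1. (LINT x:\<Omega>|lebesgue. dir_deriv e g x) = 0}"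


section \<open>Stein classes and operators\<close>

definition Fclass :: "(real^'n \<Rightarrow> real) \<Rightarrow> (real^'n \<Rightarrow> real^'n^'n) set"
  where "Fclass p = {F. \<forall>i j. (\<lambda>x. F x $ i $ j * p x) \<in> ACL1_0 (supp p)}"

definition Floc :: "(real^'n \<Rightarrow> real) \<Rightarrow> (real^'n \<Rightarrow> real^'n^'n) set"
  where "Floc p = {F. \<forall>i j. (\<lambda>x. F x $ i $ j * p x) \<in> ACL (supp p)}"

definition stein_dom :: "(real^'n \<Rightarrow> real) \<Rightarrow> (real^'n \<Rightarrow> real^'n^'n) \<Rightarrow> (real^'n \<Rightarrow> real) set"
  where "stein_dom p F = {g \<in> ACL (supp p).
    (\<lambda>x. g x *\<^sub>R F x) \<in> Fclass p \<and>
    (\<forall>e\<in>sphere 0 1. \<forall>i j. (\<lambda>x. F x $ i $ j * dir_deriv e g x) \<in> L1 p)}"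

definition T_div :: "(real^'n \<Rightarrow> real) \<Rightarrow> (real^'n \<Rightarrow> real^'n^'n) \<Rightarrow> real^'n \<Rightarrow> real^'n"
  where "T_div p F x = div_mat (\<lambda>y. p y *\<^sub>R F y) x /\<^sub>R p x"

definition stein_op ::
    "(real^'n \<Rightarrow> real) \<Rightarrow> (real^'n \<Rightarrow> real^'n^'n) \<Rightarrow> (real^'n \<Rightarrow> real) \<Rightarrow> real^'n \<Rightarrow> real"
  where "stein_op p F g x = T_div p F x \<bullet> grad g x + hs_inner (F x) (hess g x)"

text \<open>As with all derivatives of \<open>ACL\<close> functions, the gradient of a member of the Stein class
  is only required to exist almost everywhere.\<close>

definition stein_class :: "(real^'n \<Rightarrow> real) \<Rightarrow> (real^'n \<Rightarrow> real^'n^'n) \<Rightarrow> (real^'n \<Rightarrow> real) set"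
  where "stein_class p F = {g.
    (\<forall>i. AE x in lebesgue. x \<in> supp p \<longrightarrow> pderiv_exists i g x) \<and>
    (\<forall>i. (\<lambda>x. grad g x $ i) \<in> stein_dom p F)}"

definition div_term ::
    "(real^'n \<Rightarrow> real) \<Rightarrow> (real^'n \<Rightarrow> real^'n^'n) \<Rightarrow> (real^'n \<Rightarrow> real) \<Rightarrow> real^'n \<Rightarrow> real"
  where "div_term p F g = div_vec (\<lambda>x. p x *\<^sub>R (transpose (F x) *v grad g x))"

definition kappa2 ::
    "(real^'n \<Rightarrow> real) \<Rightarrow> (real^'n \<Rightarrow> real^'n^'n) \<Rightarrow> (real^'n \<Rightarrow> real) set \<Rightarrow> ennreal"
  where "kappa2 p2 F2 G = (SUP g\<in>G. ennreal \<bar>LINT x:supp p2|lebesgue. div_term p2 F2 g x\<bar>)"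

end

theory Submission
  imports Defs
begin

text \<open>If \<open>g\<close> solves the Stein equation of \<open>P\<^sub>1\<close> for \<open>h\<close>, then \<open>E\<^sub>2 h - E\<^sub>1 h = E\<^sub>2 (A\<^sub>1 g)
  = E\<^sub>2 (A\<^sub>1 g - A\<^sub>2 g) + E\<^sub>2 (A\<^sub>2 g)\<close>, and the product rule identifies \<open>E\<^sub>2 (A\<^sub>2 g)\<close> with the integral of
  \<open>div (F\<^sub>2\<^sup>T \<nabla>g p\<^sub>2)\<close>. The product rule needs the partial derivatives of functions in \<open>ACL\<close> to exist
  almost everywhere. On a line this is Lebesgue's theorem for absolutely continuous \<open>f\<close>: if the
  difference quotients of \<open>f\<close> cluster both below \<open>u\<close> and above \<open>v > u\<close> at every point of \<open>E\<close>, Vitali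
  coverings of \<open>E\<close> by intervals of either kind differ by a set of small measure, on which \<open>f\<close> varies
  little, which forces \<open>E\<close> to be null. Fubini along the lines parallel to a coordinate axis then
  covers the whole space.\<close>

section \<open>Differentiability of absolutely continuous functions\<close>

text \<open>The derivatives in the Stein operators are values of the total function
  \<open>deriv\<close>, so no product rule holds at a point until the difference quotients are known
  to converge there; membership in \<open>ACL\<close> offers only absolute continuity on almost
  every line. Two obstacles shape the passage from lines to space. Fubini needs a measurable
  exceptional set, and the set of points without a derivative is not evidently one, so the Borel set
  of points with non-Cauchy rational quotients stands in for it. Rational quotients decide
  differentiability only for functions continuous along the line, so the points on exceptional lines
  have to be shown null separately. The hyperplane bases are chosen arbitrarily, hence even for a
  coordinate axis the lines are parametrised in unknown coordinates, and a linear change of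
  variables is needed; it only has to preserve null sets. Finally, \<open>g\<close> belongs to the
  Stein class of the first operator, so nothing forces the integral of
  \<open>div_term p2 F2 g\<close> to vanish: this defect is what \<open>kappa2\<close>
  collects.\<close>

lemma sum_interval_lengths_le:
  fixes I :: "(real \<times> real) set"
  assumes "finite I" and "\<And>l r. (l, r) \<in> I \<Longrightarrow> l \<le> r \<and> {l..r} \<subseteq> U"
    and disj: "pairwise (\<lambda>(l, r) (l', r'). {l..r} \<inter> {l'..r'} = {}) I"
    and U: "U \<in> lmeasurable"
  shows "(\<Sum>(l, r)\<in>I. r - l) \<le> measure lebesgue U"
proof -
  let ?iv = "\<lambda>(l, r). {l..r} :: real set"
  have "(\<Sum>(l, r)\<in>I. r - l) = (\<Sum>i\<in>I. measure lebesgue (?iv i))"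
    using assms(2) by (intro sum.cong) auto
  also have "\<dots> = measure lebesgue (\<Union>i\<in>I. ?iv i)"
  proof (rule measure_finite_Union[symmetric])
    show "disjoint_family_on ?iv I"
      using disj unfolding disjoint_family_on_def pairwise_def by fastforce
    fix i assume "i \<in> I"
    then show "emeasure lebesgue (?iv i) \<noteq> \<infinity>"
      by (cases i) (simp add: emeasure_lborel_Icc_eq)
  qed (use assms in auto)
  also have "\<dots> \<le> measure lebesgue U"
    by (rule measure_mono_fmeasurable) (use assms in \<open>auto intro!: sets.finite_UN\<close>)
  finally show ?thesis .
qed

text \<open>Closed balls of the line are closed intervals, so the Vitali covering theorem for balls
  gives a countable disjoint family of intervals satisfying \<open>Q\<close> inside \<open>U\<close>
  that misses only a null part of \<open>E\<close>. Continuity of measure from below makes finitely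
  many of them suffice up to \<open>\<epsilon>\<close>.\<close>

lemma vitali_finite:
  fixes E U :: "real set"
  assumes E: "E \<in> lmeasurable" and U: "open U" "E \<subseteq> U" and "\<epsilon> > 0"
    and fine: "\<And>x d. x \<in> E \<Longrightarrow> d > 0 \<Longrightarrow> \<exists>l r. l < r \<and> l \<le> x \<and> x \<le> r \<and> r - l < d \<and> Q l r"
  obtains I where "finite I" "\<And>l r. (l, r) \<in> I \<Longrightarrow> l < r \<and> {l..r} \<subseteq> U \<and> Q l r"
    "pairwise (\<lambda>(l, r) (l', r'). {l..r} \<inter> {l'..r'} = {}) I"
    "measure lebesgue E - \<epsilon> < (\<Sum>(l, r)\<in>I. measure lebesgue (E \<inter> {l..r}))"
proof -
  let ?iv = "\<lambda>(l, r). {l..r} :: real set"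
  define a :: "real \<times> real \<Rightarrow> real" where "a = (\<lambda>(l, r). (l + r) / 2)"
  define rad :: "real \<times> real \<Rightarrow> real" where "rad = (\<lambda>(l, r). (r - l) / 2)"
  define K where "K = {(l, r). l < r \<and> {l..r} \<subseteq> U \<and> Q l r}"
  have ball: "cball (a i) (rad i) = ?iv i" for i
    by (cases i) (auto simp: a_def rad_def cball_eq_atLeastAtMost field_simps)
  have cov: "\<exists>i. i \<in> K \<and> x \<in> cball (a i) (rad i) \<and> rad i < d" if x: "x \<in> E" and d: "0 < d" for x d
  proof -
    obtain e where e: "e > 0" "ball x e \<subseteq> U"
      using x U by (meson open_contains_ball subsetD)
    obtain l r where lr: "l < r" "l \<le> x" "x \<le> r" "r - l < min d e" "Q l r"
      using fine[OF x, of "min d e"] d e by auto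
    have "{l..r} \<subseteq> ball x e"
      using lr by (auto simp: dist_real_def)
    then show ?thesis
      using lr e by (intro exI[of _ "(l, r)"]) (auto simp: K_def ball, auto simp: rad_def)
  qed
  obtain C where C: "countable C" "C \<subseteq> K"
    "pairwise (\<lambda>i j. disjnt (cball (a i) (rad i)) (cball (a j) (rad j))) C"
    and neg: "negligible (E - (\<Union>i\<in>C. cball (a i) (rad i)))"
  proof (rule Vitali_covering_theorem_cballs[of K rad E a, OF _ cov])
    show "0 < rad i" if "i \<in> K" for i
      using that by (auto simp: K_def rad_def)
  qed
  \<comment> \<open>Initial segments of an enumeration of \<open>C\<close> exhaust the countable
    family by an increasing sequence of finite ones.\<close>
  define Cn where "Cn n = {i \<in> C. to_nat_on C i < n}" for n
  have finC: "finite (Cn n)" for n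
  proof (rule finite_imageD)
    show "finite (to_nat_on C ` Cn n)"
      by (rule finite_subset[of _ "{..<n}"]) (auto simp: Cn_def)
    show "inj_on (to_nat_on C) (Cn n)"
      using inj_on_to_nat_on[OF C(1)] by (auto simp: Cn_def inj_on_def)
  qed
  define A where "A n = E \<inter> (\<Union>i\<in>Cn n. ?iv i)" for n
  have ivm: "(\<Union>i\<in>Cn n. ?iv i) \<in> lmeasurable" for n
    by (rule fmeasurable.finite_UN) (use finC in auto)
  have Am: "A n \<in> lmeasurable" for n
    unfolding A_def using E ivm by (intro fmeasurable.Int)
  have inc: "incseq A"
    by (force simp: incseq_def A_def Cn_def)
  have UA: "(\<Union>n. A n) = E \<inter> (\<Union>i\<in>C. ?iv i)"
    by (force simp: A_def Cn_def)
  have UAs: "(\<Union>n. A n) \<in> sets lebesgue"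
    using Am by (intro sets.countable_UN) auto
  have UAm: "(\<Union>n. A n) \<in> lmeasurable"
    by (rule fmeasurableI2[OF E _ UAs]) (auto simp: UA)
  have "measure lebesgue (\<Union>n. A n) = measure lebesgue E"
    by (rule measure_negligible_symdiff[OF E])
       (rule negligible_subset[OF neg], auto simp: UA ball)
  moreover have "(\<lambda>n. measure lebesgue (A n)) \<longlonglongrightarrow> measure lebesgue (\<Union>n. A n)"
    by (rule Lim_measure_incseq) (use Am inc UAm in \<open>auto simp: fmeasurable_def\<close>)
  ultimately have "(\<lambda>n. measure lebesgue (A n)) \<longlonglongrightarrow> measure lebesgue E" by simp
  then have "\<forall>\<^sub>F n in sequentially. measure lebesgue E - \<epsilon> < measure lebesgue (A n)"
    by (rule order_tendstoD) (use \<open>\<epsilon> > 0\<close> in auto)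
  then obtain n where n: "measure lebesgue E - \<epsilon> < measure lebesgue (A n)"
    by (auto simp: eventually_sequentially)
  have "measure lebesgue (A n) = measure lebesgue (\<Union>i\<in>Cn n. E \<inter> ?iv i)"
    by (simp add: A_def)
  also have "\<dots> \<le> (\<Sum>i\<in>Cn n. measure lebesgue (E \<inter> ?iv i))"
  proof (intro measure_UNION_le finC)
    show "E \<inter> ?iv i \<in> sets lebesgue" for i
      using E by (cases i) auto
  qed
  also have "\<dots> = (\<Sum>(l, r)\<in>Cn n. measure lebesgue (E \<inter> {l..r}))"
    by (intro sum.cong) auto
  finally have "measure lebesgue E - \<epsilon> < (\<Sum>(l, r)\<in>Cn n. measure lebesgue (E \<inter> {l..r}))"
    using n by linarith
  moreover have "l < r \<and> {l..r} \<subseteq> U \<and> Q l r" if "(l, r) \<in> Cn n" for l r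
    using that C(2) unfolding Cn_def K_def by blast
  moreover have "pairwise (\<lambda>(l, r) (l', r'). {l..r} \<inter> {l'..r'} = {}) (Cn n)"
    using C(3) by (fastforce simp: pairwise_def Cn_def ball disjnt_def)
  ultimately show thesis
    by (intro that[OF finC[of n]])
qed

text \<open>The complementary intervals \<open>K\<close> are independent of \<open>\<phi>\<close>, so that lengths and increments of a
  function can be balanced simultaneously.\<close>

lemma interval_gaps:
  fixes J :: "(real \<times> real) set"
  assumes "finite J" and "\<And>l r. (l, r) \<in> J \<Longrightarrow> a \<le> l \<and> l < r \<and> r \<le> b"
    and "pairwise (\<lambda>(l, r) (l', r'). {l<..<r} \<inter> {l'<..<r'} = {}) J" and "a \<le> b"
  shows "\<exists>K. finite K \<and> (\<forall>(l, r)\<in>K. a \<le> l \<and> l \<le> r \<and> r \<le> b) \<and>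
    pairwise (\<lambda>(l, r) (l', r'). {l<..<r} \<inter> {l'<..<r'} = {}) K \<and>
    (\<forall>\<phi> :: real \<Rightarrow> real. (\<Sum>(l, r)\<in>J. \<phi> r - \<phi> l) + (\<Sum>(l, r)\<in>K. \<phi> r - \<phi> l) = \<phi> b - \<phi> a)"
  using assms
proof (induction "card J" arbitrary: J b)
  case 0
  then show ?case by (intro exI[of _ "{(a, b)}"]) auto
next
  case (Suc n)
  have "J \<noteq> {}" using Suc.hyps(2) by auto
  \<comment> \<open>Once the rightmost interval \<open>(l, r)\<close> is removed, all others end by
    \<open>l\<close>: the induction hypothesis applies on \<open>{a..l}\<close>, and
    \<open>(r, b)\<close> is the one further gap, possibly of length zero.\<close>
  then obtain m where m: "m \<in> J" "\<And>j. j \<in> J \<Longrightarrow> fst j \<le> fst m"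
    using Suc.prems(1) finite_imageI[of J fst] Max_in[of "fst ` J"] Max_ge[of "fst ` J"]
    by (smt (verit) image_iff image_is_empty imageI)
  obtain l r where lr: "m = (l, r)" by force
  let ?J = "J - {(l, r)}"
  have J: "J = insert (l, r) ?J" using m lr by auto
  have lrb: "a \<le> l" "l < r" "r \<le> b" using Suc.prems(2)[of l r] m lr by auto
  have left: "r' \<le> l" if "(l', r') \<in> ?J" for l' r'
  proof (rule ccontr)
    assume "\<not> r' \<le> l"
    have "l' < r'" "l' \<le> l" using Suc.prems(2)[of l' r'] m(2)[of "(l', r')"] that lr by auto
    moreover have "{l<..<r} \<inter> {l'<..<r'} = {}"
      using Suc.prems(3) m lr that by (auto simp: pairwise_def)
    \<comment> \<open>Since \<open>l' \<le> l < r'\<close>, the two intervals share the points just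
      to the right of \<open>l\<close>; this midpoint is one of them.\<close>
    moreover have "(l + min r r') / 2 \<in> {l<..<r} \<inter> {l'<..<r'}"
      using \<open>\<not> r' \<le> l\<close> \<open>l' \<le> l\<close> lrb by (auto simp: field_simps min_def)
    ultimately show False by blast
  qed
  have IHJ: "a \<le> l' \<and> l' < r' \<and> r' \<le> l" if "(l', r') \<in> ?J" for l' r'
    using Suc.prems(2)[of l' r'] left[OF that] that by auto
  have "n = card ?J" using Suc.hyps(2) Suc.prems(1) m lr by simp
  moreover have "pairwise (\<lambda>(l, r) (l', r'). {l<..<r} \<inter> {l'<..<r'} = {}) ?J"
    using Suc.prems(3) by (rule pairwise_subset) auto
  ultimately have "\<exists>K. finite K \<and> (\<forall>(l', r')\<in>K. a \<le> l' \<and> l' \<le> r' \<and> r' \<le> l) \<and>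
    pairwise (\<lambda>(l, r) (l', r'). {l<..<r} \<inter> {l'<..<r'} = {}) K \<and>
    (\<forall>\<phi> :: real \<Rightarrow> real. (\<Sum>(l, r)\<in>?J. \<phi> r - \<phi> l) + (\<Sum>(l, r)\<in>K. \<phi> r - \<phi> l) = \<phi> l - \<phi> a)"
    by (intro Suc.hyps(1) IHJ) (use Suc.prems(1) lrb in auto)
  then obtain K where K: "finite K" "\<forall>(l', r')\<in>K. a \<le> l' \<and> l' \<le> r' \<and> r' \<le> l"
    "pairwise (\<lambda>(l, r) (l', r'). {l<..<r} \<inter> {l'<..<r'} = {}) K"
    "\<forall>\<phi> :: real \<Rightarrow> real. (\<Sum>(l, r)\<in>?J. \<phi> r - \<phi> l) + (\<Sum>(l, r)\<in>K. \<phi> r - \<phi> l) = \<phi> l - \<phi> a"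
    by blast
  have new: "(r, b) \<notin> K" using K(2) lrb by auto
  show ?case
  proof (intro exI[of _ "insert (r, b) K"] conjI allI)
    show "pairwise (\<lambda>(l, r) (l', r'). {l<..<r} \<inter> {l'<..<r'} = {}) (insert (r, b) K)"
    proof (unfold pairwise_insert, intro conjI allI impI K(3))
      fix z assume z: "z \<in> K \<and> z \<noteq> (r, b)"
      then have "snd z \<le> l" using bspec[OF K(2), of z] by (auto simp: case_prod_unfold)
      then show "(case (r, b) of (l, r) \<Rightarrow> \<lambda>(l', r'). {l<..<r} \<inter> {l'<..<r'} = {}) z"
        "(case z of (l, r) \<Rightarrow> \<lambda>(l', r'). {l<..<r} \<inter> {l'<..<r'} = {}) (r, b)"
        using lrb by (auto simp: case_prod_unfold)
    qed
    fix \<phi> :: "real \<Rightarrow> real"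
    have "(\<Sum>(l, r)\<in>J. \<phi> r - \<phi> l) = (\<phi> r - \<phi> l) + (\<Sum>(l, r)\<in>?J. \<phi> r - \<phi> l)"
      by (subst J, subst sum.insert) (use Suc.prems(1) in auto)
    moreover have "(\<Sum>(l, r)\<in>insert (r, b) K. \<phi> r - \<phi> l) = (\<phi> b - \<phi> r) + (\<Sum>(l, r)\<in>K. \<phi> r - \<phi> l)"
      by (subst sum.insert) (use K(1) new in auto)
    ultimately show "(\<Sum>(l, r)\<in>J. \<phi> r - \<phi> l) + (\<Sum>(l, r)\<in>insert (r, b) K. \<phi> r - \<phi> l) = \<phi> b - \<phi> a"
      using spec[OF K(4), of \<phi>] by linarith
    show "\<forall>(l, r)\<in>insert (r, b) K. a \<le> l \<and> l \<le> r \<and> r \<le> b"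
      using K(2) lrb by (auto simp: case_prod_unfold)
  qed (use K(1) in simp)
qed


section \<open>Null sets of points with oscillating or unbounded difference quotients\<close>

lemma Icc_subset_IooD:
  fixes l r :: real
  assumes "{l..r} \<subseteq> {a<..<b}" "l \<le> r"
  shows "a < l" "r < b"
  using assms by (meson atLeastAtMost_iff greaterThanLessThan_iff order_refl subsetD)+

lemma pairwise_disjoint_Icc_imp_Ioo:
  fixes I :: "(real \<times> real) set"
  assumes "pairwise (\<lambda>(l, r) (l', r'). {l..r} \<inter> {l'..r'} = {}) I"
  shows "pairwise (\<lambda>(l, r) (l', r'). {l<..<r} \<inter> {l'<..<r'} = {}) I"
proof (rule pairwise_mono[OF assms _ order_refl], clarify)
  fix l r l' r' :: real
  assume "{l..r} \<inter> {l'..r'} = {}"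
  moreover have "{l<..<r} \<inter> {l'<..<r'} \<subseteq> {l..r} \<inter> {l'..r'}" by auto
  ultimately show "{l<..<r} \<inter> {l'<..<r'} = {}" by blast
qed

lemma measure_Int_Icc_eq_Ioo:
  fixes l r :: real
  assumes "E \<in> lmeasurable"
  shows "measure lebesgue (E \<inter> {l..r}) = measure lebesgue (E \<inter> {l<..<r})"
proof (rule measure_negligible_symdiff)
  show "E \<inter> {l<..<r} \<in> lmeasurable"
    using assms by (rule fmeasurable.Int) auto
  show "negligible (E \<inter> {l<..<r} - E \<inter> {l..r} \<union> (E \<inter> {l..r} - E \<inter> {l<..<r}))"
    by (rule negligible_subset[of "{l, r}"]) auto
qed

lemma measure_Int_Icc_le:
  fixes l r :: real
  assumes "E \<in> sets lebesgue" "l \<le> r"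
  shows "measure lebesgue (E \<inter> {l..r}) \<le> r - l"
proof -
  have "measure lebesgue (E \<inter> {l..r}) \<le> measure lebesgue {l..r}"
    by (rule measure_mono_fmeasurable) (use assms in auto)
  then show ?thesis using assms by simp
qed

text \<open>The steep intervals are chosen inside the flat ones, so both families compete for the
  same increments: over \<open>I\<close> the increment is at most \<open>u * SI\<close>, and at
  least \<open>v * (SI - SK)\<close> plus the increment \<open>DK\<close> over the gaps. With
  \<open>SK\<close> and \<open>DK\<close> small and \<open>SI\<close> almost as large as the measure
  \<open>m\<close> of \<open>E\<close> at least, \<open>(v - u) * m\<close> has to be small.\<close>

lemma abs_continuous_ratio_null:
  assumes ac: "abs_continuous_on a b f" and E: "E \<in> lmeasurable" "E \<subseteq> {a<..<b}" and "u < v"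
    and lower: "\<And>x d. x \<in> E \<Longrightarrow> d > 0 \<Longrightarrow>
      \<exists>l r. l < r \<and> l \<le> x \<and> x \<le> r \<and> r - l < d \<and> f r - f l < u * (r - l)"
    and upper: "\<And>x d. x \<in> E \<Longrightarrow> d > 0 \<Longrightarrow>
      \<exists>l r. l < r \<and> l \<le> x \<and> x \<le> r \<and> r - l < d \<and> v * (r - l) < f r - f l"
  shows "measure lebesgue E = 0"
proof (rule ccontr)
  define m where "m = measure lebesgue E"
  assume "measure lebesgue E \<noteq> 0"
  then have m: "m > 0" by (simp add: m_def order.not_eq_order_implies_strict)
  have key: "(v - u) * m \<le> \<eta> * (1 + 3 * \<bar>v\<bar> + (v - u))" if "\<eta> > 0" for \<eta>
  proof -
    obtain \<delta> where \<delta>: "\<delta> > 0" and AC: "\<And>I :: (real \<times> real) set. finite I \<Longrightarrow>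
        (\<forall>(l, r)\<in>I. a \<le> l \<and> l \<le> r \<and> r \<le> b) \<Longrightarrow>
        pairwise (\<lambda>(l, r) (l', r'). {l<..<r} \<inter> {l'<..<r'} = {}) I \<Longrightarrow>
        (\<Sum>(l, r)\<in>I. r - l) < \<delta> \<Longrightarrow> (\<Sum>(l, r)\<in>I. \<bar>f r - f l\<bar>) < \<eta>"
      using ac \<open>\<eta> > 0\<close> unfolding abs_continuous_on_def by meson
    \<comment> \<open>Three errors of size \<open>\<epsilon>\<close> add up in the gap length
      \<open>SK\<close>: the excess of \<open>U\<close> over \<open>E\<close>, what \<open>I\<close>
      misses of \<open>E\<close>, and what all inner families miss together. A third of
      \<open>\<delta>\<close> keeps the sum within \<open>\<delta>\<close>; the bound by
      \<open>\<eta>\<close> enters the final estimate.\<close>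
    define \<epsilon> where "\<epsilon> = min (\<delta> / 3) \<eta>"
    have \<epsilon>: "\<epsilon> > 0" "3 * \<epsilon> \<le> \<delta>" "\<epsilon> \<le> \<eta>" using \<delta> \<open>\<eta> > 0\<close> by (auto simp: \<epsilon>_def min_def)
    obtain V where V: "open V" "E \<subseteq> V" and VE: "V - E \<in> lmeasurable" "emeasure lebesgue (V - E) < ennreal \<epsilon>"
      using sets_lebesgue_outer_open[OF _ \<epsilon>(1), of E] E by blast
    have V_eq: "V = E \<union> (V - E)" using V by blast
    have Vm: "V \<in> lmeasurable" by (subst V_eq) (intro fmeasurable.Un E VE)
    have "measure lebesgue V \<le> m + measure lebesgue (V - E)"
      unfolding m_def by (subst V_eq) (intro measure_Un_le fmeasurableD E VE)
    moreover have "measure lebesgue (V - E) < \<epsilon>"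
      using VE(2) by (simp add: emeasure_eq_measure2[OF VE(1)] ennreal_less_iff)
    ultimately have mV: "measure lebesgue V < m + \<epsilon>" by linarith
    define U where "U = V \<inter> {a<..<b}"
    have Um: "U \<in> lmeasurable" unfolding U_def using Vm by (intro fmeasurable.Int) auto
    have "measure lebesgue U \<le> measure lebesgue V"
      by (rule measure_mono_fmeasurable) (use Vm Um in \<open>auto simp: U_def\<close>)
    then have U: "open U" "E \<subseteq> U" "measure lebesgue U < m + \<epsilon>" "U \<subseteq> {a<..<b}"
      using V E mV by (auto simp: U_def)
    obtain I where I: "finite I" "\<And>l r. (l, r) \<in> I \<Longrightarrow> l < r \<and> {l..r} \<subseteq> U \<and> f r - f l < u * (r - l)"
      and disj: "pairwise (\<lambda>(l, r) (l', r'). {l..r} \<inter> {l'..r'} = {}) I"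
      and mI: "m - \<epsilon> < (\<Sum>(l, r)\<in>I. measure lebesgue (E \<inter> {l..r}))"
      unfolding m_def using vitali_finite[OF E(1) U(1,2) \<epsilon>(1) lower] by metis
    define SI where "SI = (\<Sum>(l, r)\<in>I. r - l)"
    have SIU: "SI \<le> measure lebesgue U"
      unfolding SI_def
    proof (rule sum_interval_lengths_le[OF I(1) _ disj Um])
      show "l \<le> r \<and> {l..r} \<subseteq> U" if "(l, r) \<in> I" for l r
        using I(2)[OF that] by simp
    qed
    \<comment> \<open>One error \<open>\<epsilon>\<close> is shared among the members of
      \<open>I\<close>; the \<open>+ 1\<close> takes care of an empty \<open>I\<close>.\<close>
    define \<epsilon>' where "\<epsilon>' = \<epsilon> / (real (card I) + 1)"
    have \<epsilon>': "\<epsilon>' > 0" "real (card I) * \<epsilon>' \<le> \<epsilon>" using \<epsilon> by (auto simp: \<epsilon>'_def field_simps)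
    have ex: "\<exists>K. finite K \<and> (\<forall>(x, y)\<in>K. fst k \<le> x \<and> x \<le> y \<and> y \<le> snd k) \<and>
        pairwise (\<lambda>(l, r) (l', r'). {l<..<r} \<inter> {l'<..<r'} = {}) K \<and>
        (\<Sum>(x, y)\<in>K. y - x) \<le> (snd k - fst k) - measure lebesgue (E \<inter> {fst k..snd k}) + \<epsilon>' \<and>
        v * ((snd k - fst k) - (\<Sum>(x, y)\<in>K. y - x)) \<le> (f (snd k) - f (fst k)) - (\<Sum>(x, y)\<in>K. f y - f x)"
      if k: "k \<in> I" for k
    proof -
      obtain l r where lr: "k = (l, r)" "l < r" using I(2) k by (cases k) auto
      \<comment> \<open>The covering lemma asks for an open surrounding set, so the endpoints are
        dropped; \<open>measure_Int_Icc_eq_Ioo\<close> shows that this costs no measure.\<close>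
      let ?E = "E \<inter> {l<..<r}"
      have Em: "?E \<in> lmeasurable" using E by (intro fmeasurable.Int) auto
      obtain J where J: "finite J"
        "\<And>x y. (x, y) \<in> J \<Longrightarrow> x < y \<and> {x..y} \<subseteq> {l<..<r} \<and> v * (y - x) < f y - f x"
        "pairwise (\<lambda>(l, r) (l', r'). {l..r} \<inter> {l'..r'} = {}) J"
        "measure lebesgue ?E - \<epsilon>' < (\<Sum>(x, y)\<in>J. measure lebesgue (?E \<inter> {x..y}))"
        using vitali_finite[of ?E "{l<..<r}" \<epsilon>' "\<lambda>x y. v * (y - x) < f y - f x"] Em \<epsilon>'(1) upper
        by (metis IntD1 Int_lower2 open_greaterThanLessThan)
      have Jb: "l \<le> x \<and> x < y \<and> y \<le> r" if "(x, y) \<in> J" for x y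
        using J(2)[OF that] Icc_subset_IooD[of x y l r] by auto
      have "pairwise (\<lambda>(l, r) (l', r'). {l<..<r} \<inter> {l'<..<r'} = {}) J"
        using J(3) by (rule pairwise_disjoint_Icc_imp_Ioo)
      then obtain K where K: "finite K" "\<forall>(x, y)\<in>K. l \<le> x \<and> x \<le> y \<and> y \<le> r"
        "pairwise (\<lambda>(l, r) (l', r'). {l<..<r} \<inter> {l'<..<r'} = {}) K"
        and sums: "\<forall>\<phi> :: real \<Rightarrow> real. (\<Sum>(l, r)\<in>J. \<phi> r - \<phi> l) + (\<Sum>(l, r)\<in>K. \<phi> r - \<phi> l) = \<phi> r - \<phi> l"
        using interval_gaps[OF J(1) Jb] lr(2) by (meson less_imp_le)
      have "(\<Sum>(x, y)\<in>J. measure lebesgue (?E \<inter> {x..y})) \<le> (\<Sum>(x, y)\<in>J. y - x)"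
      proof (rule sum_mono, clarify)
        fix x y assume "(x, y) \<in> J"
        then show "measure lebesgue (?E \<inter> {x..y}) \<le> y - x"
          using Jb[of x y] Em by (intro measure_Int_Icc_le) auto
      qed
      then have 1: "(\<Sum>(x, y)\<in>K. y - x) \<le> (r - l) - measure lebesgue (E \<inter> {l..r}) + \<epsilon>'"
        using J(4) spec[OF sums, of "\<lambda>x. x"] measure_Int_Icc_eq_Ioo[OF E(1), of l r] by linarith
      have "v * (\<Sum>(x, y)\<in>J. y - x) = (\<Sum>(x, y)\<in>J. v * (y - x))"
        by (simp add: sum_distrib_left case_prod_unfold)
      also have "\<dots> \<le> (\<Sum>(x, y)\<in>J. f y - f x)"
        by (rule sum_mono) (use J(2) in \<open>fastforce simp: less_imp_le\<close>)
      also have "\<dots> = (f r - f l) - (\<Sum>(x, y)\<in>K. f y - f x)"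
        using spec[OF sums, of f] by linarith
      also have "(\<Sum>(x, y)\<in>J. y - x) = (r - l) - (\<Sum>(x, y)\<in>K. y - x)"
        using spec[OF sums, of "\<lambda>x. x"] by linarith
      finally have "v * ((r - l) - (\<Sum>(x, y)\<in>K. y - x)) \<le> (f r - f l) - (\<Sum>(x, y)\<in>K. f y - f x)" .
      with 1 K show ?thesis unfolding lr fst_conv snd_conv by (intro exI[of _ K]) blast
    qed
    have "\<exists>K. \<forall>k\<in>I. finite (K k) \<and> (\<forall>(x, y)\<in>K k. fst k \<le> x \<and> x \<le> y \<and> y \<le> snd k) \<and>
        pairwise (\<lambda>(l, r) (l', r'). {l<..<r} \<inter> {l'<..<r'} = {}) (K k) \<and>
        (\<Sum>(x, y)\<in>K k. y - x) \<le> (snd k - fst k) - measure lebesgue (E \<inter> {fst k..snd k}) + \<epsilon>' \<and>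
        v * ((snd k - fst k) - (\<Sum>(x, y)\<in>K k. y - x)) \<le> (f (snd k) - f (fst k)) - (\<Sum>(x, y)\<in>K k. f y - f x)"
      by (intro bchoice ballI ex)
    then obtain K where K: "\<forall>k\<in>I. finite (K k) \<and> (\<forall>(x, y)\<in>K k. fst k \<le> x \<and> x \<le> y \<and> y \<le> snd k) \<and>
        pairwise (\<lambda>(l, r) (l', r'). {l<..<r} \<inter> {l'<..<r'} = {}) (K k) \<and>
        (\<Sum>(x, y)\<in>K k. y - x) \<le> (snd k - fst k) - measure lebesgue (E \<inter> {fst k..snd k}) + \<epsilon>' \<and>
        v * ((snd k - fst k) - (\<Sum>(x, y)\<in>K k. y - x)) \<le> (f (snd k) - f (fst k)) - (\<Sum>(x, y)\<in>K k. f y - f x)" ..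
    have Kfin: "finite (K k)"
      and Kin: "\<forall>(x, y)\<in>K k. fst k \<le> x \<and> x \<le> y \<and> y \<le> snd k"
      and Kpw: "pairwise (\<lambda>(l, r) (l', r'). {l<..<r} \<inter> {l'<..<r'} = {}) (K k)"
      and Klen: "(\<Sum>(x, y)\<in>K k. y - x) \<le> (snd k - fst k) - measure lebesgue (E \<inter> {fst k..snd k}) + \<epsilon>'"
      and Kv: "v * ((snd k - fst k) - (\<Sum>(x, y)\<in>K k. y - x)) \<le> (f (snd k) - f (fst k)) - (\<Sum>(x, y)\<in>K k. f y - f x)"
      if "k \<in> I" for k
      using bspec[OF K that] by - (elim conjE, assumption)+
    have Kb: "fst k \<le> fst z \<and> fst z \<le> snd z \<and> snd z \<le> snd k" if "k \<in> I" "z \<in> K k" for k z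
      using bspec[OF Kin[OF that(1)] that(2)] by (simp add: case_prod_unfold)
    have Idisj: "{fst k..snd k} \<inter> {fst k'..snd k'} = {}" if "k \<in> I" "k' \<in> I" "k \<noteq> k'" for k k'
      using pairwiseD[OF disj that] by (simp add: case_prod_unfold)
    \<comment> \<open>Gaps may be degenerate, so disjoint interiors would not keep the families of
      different \<open>k\<close> apart: a common endpoint could be a gap of both. This is why the
      closed intervals of \<open>I\<close> are disjoint.\<close>
    have Kdisj: "K k \<inter> K k' = {}" if "k \<in> I" "k' \<in> I" "k \<noteq> k'" for k k'
    proof (rule ccontr)
      assume "K k \<inter> K k' \<noteq> {}"
      then obtain z where "z \<in> K k" "z \<in> K k'" by blast
      then have "fst z \<in> {fst k..snd k} \<inter> {fst k'..snd k'}"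
        using Kb[OF that(1), of z] Kb[OF that(2), of z] by auto
      then show False using Idisj[OF that] by blast
    qed
    let ?K = "\<Union>k\<in>I. K k"
    have sumK: "(\<Sum>z\<in>?K. \<phi> z) = (\<Sum>k\<in>I. \<Sum>z\<in>K k. \<phi> z)" for \<phi> :: "real \<times> real \<Rightarrow> real"
      by (rule sum.UNION_disjoint) (use I(1) Kfin Kdisj in simp_all)
    define SK where "SK = (\<Sum>(x, y)\<in>?K. y - x)"
    define DK where "DK = (\<Sum>(x, y)\<in>?K. f y - f x)"
    define DI where "DI = (\<Sum>(l, r)\<in>I. f r - f l)"
    have "SK = (\<Sum>k\<in>I. \<Sum>(x, y)\<in>K k. y - x)"
      unfolding SK_def by (rule sumK)
    also have "\<dots> \<le> (\<Sum>k\<in>I. (snd k - fst k) - measure lebesgue (E \<inter> {fst k..snd k}) + \<epsilon>')"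
      by (rule sum_mono) (use K in blast)
    also have "\<dots> = SI - (\<Sum>(l, r)\<in>I. measure lebesgue (E \<inter> {l..r})) + real (card I) * \<epsilon>'"
      by (simp add: SI_def sum.distrib sum_subtractf case_prod_unfold)
    finally have SK: "SK < 3 * \<epsilon>"
      using mI SIU U(3) \<epsilon>'(2) by linarith
    have SK0: "SK \<ge> 0"
      unfolding SK_def by (rule sum_nonneg) (use Kb in \<open>auto simp: case_prod_unfold\<close>)
    have "(\<Sum>(x, y)\<in>?K. \<bar>f y - f x\<bar>) < \<eta>"
    proof (rule AC)
      show "finite ?K" using I(1) Kfin by blast
      show "\<forall>(l, r)\<in>?K. a \<le> l \<and> l \<le> r \<and> r \<le> b"
      proof (clarify)
        fix k x y assume k: "k \<in> I" "(x, y) \<in> K k"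
        then have "{fst k..snd k} \<subseteq> {a<..<b}" "fst k < snd k"
          using I(2)[of "fst k" "snd k"] U(4) by auto
        then show "a \<le> x \<and> x \<le> y \<and> y \<le> b"
          using Kb[OF k] Icc_subset_IooD[of "fst k" "snd k" a b] by auto
      qed
      show "pairwise (\<lambda>(l, r) (l', r'). {l<..<r} \<inter> {l'<..<r'} = {}) ?K"
      proof (rule pairwiseI)
        fix z z' assume z: "z \<in> ?K" "z' \<in> ?K" "z \<noteq> z'"
        obtain k k' where k: "k \<in> I" "z \<in> K k" "k' \<in> I" "z' \<in> K k'" using z by blast
        have "{fst z<..<snd z} \<inter> {fst z'<..<snd z'} = {}"
        proof (cases "k = k'")
          case True
          then show ?thesis
            using pairwiseD[OF Kpw[OF k(1)] k(2), of z'] k(4) z(3) by (simp add: case_prod_unfold)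
        next
          case False
          have "{fst z<..<snd z} \<subseteq> {fst k..snd k}" "{fst z'<..<snd z'} \<subseteq> {fst k'..snd k'}"
            using Kb[OF k(1,2)] Kb[OF k(3,4)] by auto
          then show ?thesis using Idisj[OF k(1,3) False] by blast
        qed
        then show "(\<lambda>(l, r) (l', r'). {l<..<r} \<inter> {l'<..<r'} = {}) z z'"
          by (simp add: case_prod_unfold)
      qed
      show "(\<Sum>(x, y)\<in>?K. y - x) < \<delta>" using SK \<epsilon> by (simp add: SK_def)
    qed
    moreover have "\<bar>DK\<bar> \<le> (\<Sum>(x, y)\<in>?K. \<bar>f y - f x\<bar>)"
      unfolding DK_def by (rule order_trans[OF sum_abs]) (simp add: case_prod_unfold)
    ultimately have DK: "\<bar>DK\<bar> < \<eta>" by linarith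
    have "v * (SI - SK) = (\<Sum>k\<in>I. v * ((snd k - fst k) - (\<Sum>(x, y)\<in>K k. y - x)))"
      unfolding sum_distrib_left[symmetric]
      by (subst sum_subtractf) (simp add: SI_def SK_def sumK case_prod_unfold)
    also have "\<dots> \<le> (\<Sum>k\<in>I. (f (snd k) - f (fst k)) - (\<Sum>(x, y)\<in>K k. f y - f x))"
      by (rule sum_mono) (use K in blast)
    also have "\<dots> = DI - DK"
      by (simp add: DI_def DK_def sumK sum_subtractf case_prod_unfold)
    finally have 1: "v * (SI - SK) \<le> DI - DK" .
    have "DI \<le> (\<Sum>(l, r)\<in>I. u * (r - l))"
      unfolding DI_def by (rule sum_mono) (use I(2) in \<open>fastforce simp: less_imp_le\<close>)
    also have "\<dots> = u * SI"
      by (simp add: SI_def sum_distrib_left case_prod_unfold)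
    finally have 2: "(v - u) * SI \<le> \<eta> + v * SK" using 1 DK by (simp add: algebra_simps)
    have "v * SK \<le> \<bar>v\<bar> * SK" using SK0 by (simp add: mult_right_mono)
    also have "\<dots> \<le> \<bar>v\<bar> * (3 * \<eta>)" using SK \<epsilon> by (intro mult_left_mono) auto
    finally have 3: "(v - u) * SI \<le> \<eta> + 3 * \<bar>v\<bar> * \<eta>" using 2 by simp
    have "(\<Sum>(l, r)\<in>I. measure lebesgue (E \<inter> {l..r})) \<le> SI"
      unfolding SI_def
    proof (rule sum_mono, clarify)
      fix l r assume "(l, r) \<in> I"
      then show "measure lebesgue (E \<inter> {l..r}) \<le> r - l"
        using I(2)[of l r] E by (intro measure_Int_Icc_le) auto
    qed
    then have "(v - u) * (m - \<eta>) \<le> (v - u) * SI"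
      using mI \<epsilon> \<open>u < v\<close> by (intro mult_left_mono) auto
    with 3 show ?thesis by (simp add: algebra_simps)
  qed
  \<comment> \<open>With \<open>\<eta> = (v - u) * m / (2 * c)\<close> the estimate
    \<open>key\<close> bounds \<open>(v - u) * m\<close> by half of itself.\<close>
  define c where "c = 1 + 3 * \<bar>v\<bar> + (v - u)"
  have "c > 0" "(v - u) * m > 0" using \<open>u < v\<close> m by (auto simp: c_def)
  then have "(v - u) * m \<le> ((v - u) * m / (2 * c)) * c"
    using key[of "(v - u) * m / (2 * c)"] unfolding c_def[symmetric] by simp
  also have "\<dots> = (v - u) * m / 2" using \<open>c > 0\<close> by simp
  finally show False using \<open>(v - u) * m > 0\<close> by linarith
qed

text \<open>If a piece of \<open>E\<close> had measure \<open>m > 0\<close>, disjoint intervals of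
  slope above \<open>2 / m\<close> covering more than half of it would have increments adding up to
  at least 1. On windows of length \<open>\<delta> / 2\<close>, with \<open>\<delta>\<close> taken
  for the bound 1, absolute continuity forbids this; countably many such windows cover
  \<open>E\<close>.\<close>

lemma abs_continuous_infinite_ratio_null:
  assumes ac: "abs_continuous_on a b f" and E: "E \<in> lmeasurable" "E \<subseteq> {a<..<b}"
    and large: "\<And>x d M. x \<in> E \<Longrightarrow> d > 0 \<Longrightarrow>
      \<exists>l r. l < r \<and> l \<le> x \<and> x \<le> r \<and> r - l < d \<and> M * (r - l) < \<bar>f r - f l\<bar>"
  shows "negligible E"
proof -
  obtain \<delta> where \<delta>: "\<delta> > 0" and AC: "\<And>I :: (real \<times> real) set. finite I \<Longrightarrow>
      (\<forall>(l, r)\<in>I. a \<le> l \<and> l \<le> r \<and> r \<le> b) \<Longrightarrow>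
      pairwise (\<lambda>(l, r) (l', r'). {l<..<r} \<inter> {l'<..<r'} = {}) I \<Longrightarrow>
      (\<Sum>(l, r)\<in>I. r - l) < \<delta> \<Longrightarrow> (\<Sum>(l, r)\<in>I. \<bar>f r - f l\<bar>) < 1"
    using ac unfolding abs_continuous_on_def by (meson zero_less_one)
  have "negligible (E \<inter> {c<..<c + \<delta> / 2})" (is "negligible ?E") for c
  proof (rule ccontr)
    assume neg: "\<not> negligible ?E"
    have Em: "?E \<in> lmeasurable" using E by (intro fmeasurable.Int) auto
    define m where "m = measure lebesgue ?E"
    have m: "m > 0"
      using neg Em by (simp add: m_def negligible_iff_measure order.not_eq_order_implies_strict)
    let ?U = "{a<..<b} \<inter> {c<..<c + \<delta> / 2}"
    have fine: "\<exists>l r. l < r \<and> l \<le> x \<and> x \<le> r \<and> r - l < d \<and> 2 / m * (r - l) < \<bar>f r - f l\<bar>"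
      if "x \<in> ?E" "d > 0" for x d
      using large[OF _ that(2), of x "2 / m"] that(1) by blast
    have open_U: "open ?U" and sub_U: "?E \<subseteq> ?U" and m2: "m / 2 > 0" using m E by auto
    obtain I where I: "finite I"
      "\<And>l r. (l, r) \<in> I \<Longrightarrow> l < r \<and> {l..r} \<subseteq> ?U \<and> 2 / m * (r - l) < \<bar>f r - f l\<bar>"
      "pairwise (\<lambda>(l, r) (l', r'). {l..r} \<inter> {l'..r'} = {}) I"
      "m - m / 2 < (\<Sum>(l, r)\<in>I. measure lebesgue (?E \<inter> {l..r}))"
      by (rule vitali_finite[OF Em open_U sub_U m2 fine, folded m_def]) (assumption | rule that)+
    have "(\<Sum>(l, r)\<in>I. r - l) \<le> measure lebesgue {c<..<c + \<delta> / 2}"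
    proof (rule sum_interval_lengths_le[OF I(1) _ I(3)])
      show "l \<le> r \<and> {l..r} \<subseteq> {c<..<c + \<delta> / 2}" if "(l, r) \<in> I" for l r
        using I(2)[OF that] by (simp only: le_inf_iff less_imp_le)
    qed simp
    then have len: "(\<Sum>(l, r)\<in>I. r - l) < \<delta>" using \<delta> by simp
    have "(\<Sum>(l, r)\<in>I. measure lebesgue (?E \<inter> {l..r})) \<le> (\<Sum>(l, r)\<in>I. r - l)"
    proof (rule sum_mono, clarify)
      fix l r assume "(l, r) \<in> I"
      then show "measure lebesgue (?E \<inter> {l..r}) \<le> r - l"
        using I(2)[of l r] Em by (intro measure_Int_Icc_le) auto
    qed
    then have "1 \<le> 2 / m * (\<Sum>(l, r)\<in>I. r - l)" using I(4) m by (simp add: field_simps)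
    also have "\<dots> = (\<Sum>(l, r)\<in>I. 2 / m * (r - l))"
      by (simp add: sum_distrib_left case_prod_unfold)
    also have "\<dots> \<le> (\<Sum>(l, r)\<in>I. \<bar>f r - f l\<bar>)"
      by (rule sum_mono) (use I(2) in \<open>fastforce simp: less_imp_le\<close>)
    also have "\<dots> < 1"
    proof (rule AC[OF I(1) _ _ len])
      show "\<forall>(l, r)\<in>I. a \<le> l \<and> l \<le> r \<and> r \<le> b"
      proof clarify
        fix l r assume "(l, r) \<in> I"
        then have "l < r" "{l..r} \<subseteq> {a<..<b}" using I(2)[of l r] by auto
        then show "a \<le> l \<and> l \<le> r \<and> r \<le> b" using Icc_subset_IooD[of l r a b] by auto
      qed
      show "pairwise (\<lambda>(l, r) (l', r'). {l<..<r} \<inter> {l'<..<r'} = {}) I"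
        using I(3) by (rule pairwise_disjoint_Icc_imp_Ioo)
    qed
    finally show False by simp
  qed
  then have "negligible (\<Union>c\<in>\<rat>. E \<inter> {c<..<c + \<delta> / 2})"
    by (intro negligible_countable_Union) (auto simp: countable_rat)
  moreover have "E \<subseteq> (\<Union>c\<in>\<rat>. E \<inter> {c<..<c + \<delta> / 2})"
  proof
    fix x assume "x \<in> E"
    moreover obtain c where "c \<in> \<rat>" "x - \<delta> / 2 < c" "c < x"
      using Rats_dense_in_real[of "x - \<delta> / 2" x] \<delta> by auto
    ultimately show "x \<in> (\<Union>c\<in>\<rat>. E \<inter> {c<..<c + \<delta> / 2})"
      by (intro UN_I[of c]) auto
  qed
  ultimately show ?thesis by (rule negligible_subset)
qed

section \<open>From null exceptional sets to differentiability almost everywhere on a line\<close>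

lemma abs_continuous_on_imp_continuous_on:
  assumes "abs_continuous_on a b f"
  shows "continuous_on {a..b} f"
  unfolding continuous_on_iff
proof (intro ballI allI impI)
  fix x e :: real assume x: "x \<in> {a..b}" and "e > 0"
  then obtain d where d: "d > 0" and AC: "\<And>I :: (real \<times> real) set. finite I \<Longrightarrow>
      (\<forall>(l, r)\<in>I. a \<le> l \<and> l \<le> r \<and> r \<le> b) \<Longrightarrow>
      pairwise (\<lambda>(l, r) (l', r'). {l<..<r} \<inter> {l'<..<r'} = {}) I \<Longrightarrow>
      (\<Sum>(l, r)\<in>I. r - l) < d \<Longrightarrow> (\<Sum>(l, r)\<in>I. \<bar>f r - f l\<bar>) < e"
    using assms unfolding abs_continuous_on_def by meson
  have "dist (f y) (f x) < e" if "y \<in> {a..b}" "dist y x < d" for y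
  proof (cases "x \<le> y")
    case True
    then show ?thesis using AC[of "{(x, y)}"] that x by (auto simp: dist_real_def)
  next
    case False
    then show ?thesis using AC[of "{(y, x)}"] that x by (auto simp: dist_real_def abs_minus_commute)
  qed
  then show "\<exists>d>0. \<forall>y\<in>{a..b}. dist y x < d \<longrightarrow> dist (f y) (f x) < e"
    using d by blast
qed

text \<open>The limit is the supremum of the eventual lower bounds of \<open>q\<close>: a rational
  \<open>u\<close> above it is not an eventual lower bound, so every rational \<open>v > u\<close>
  is an eventual upper bound. Boundedness makes the set of lower bounds nonempty and bounded
  above.\<close>

lemma tendsto_if_no_rational_oscillation:
  fixes q :: "'a \<Rightarrow> real"
  assumes F: "F \<noteq> bot" and bounded: "\<forall>\<^sub>F h in F. \<bar>q h\<bar> \<le> M"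
    and no_osc: "\<And>u v. u \<in> \<rat> \<Longrightarrow> v \<in> \<rat> \<Longrightarrow> u < v \<Longrightarrow> (\<forall>\<^sub>F h in F. u \<le> q h) \<or> (\<forall>\<^sub>F h in F. q h \<le> v)"
  shows "\<exists>L. (q \<longlongrightarrow> L) F"
proof -
  define S where "S = {u. \<forall>\<^sub>F h in F. u \<le> q h}"
  have "- M \<in> S"
    using bounded unfolding S_def mem_Collect_eq by eventually_elim linarith
  have "u \<le> M" if "u \<in> S" for u
  proof -
    have "\<forall>\<^sub>F h in F. u \<le> M"
      using bounded that unfolding S_def mem_Collect_eq by eventually_elim linarith
    then show ?thesis using F by (simp add: eventually_const)
  qed
  then have bdd: "bdd_above S" by (rule bdd_aboveI)
  have "(q \<longlongrightarrow> Sup S) F"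
  proof (rule order_tendstoI)
    fix x assume "x < Sup S"
    then obtain u where "u \<in> S" "x < u"
      using less_cSup_iff[OF _ bdd] \<open>- M \<in> S\<close> by blast
    then show "\<forall>\<^sub>F h in F. x < q h"
      unfolding S_def mem_Collect_eq by (auto elim: eventually_mono)
  next
    fix x assume "Sup S < x"
    then obtain v where v: "v \<in> \<rat>" "Sup S < v" "v < x" using Rats_dense_in_real by blast
    then obtain u where u: "u \<in> \<rat>" "Sup S < u" "u < v" using Rats_dense_in_real by blast
    have "u \<notin> S" using cSup_upper[OF _ bdd, of u] u(2) by auto
    then have "\<forall>\<^sub>F h in F. q h \<le> v" using no_osc[OF u(1) v(1) u(3)] by (auto simp: S_def)
    then show "\<forall>\<^sub>F h in F. q h < x" by eventually_elim (use v in linarith)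
  qed
  then show ?thesis by blast
qed

text \<open>For \<open>T\<close> a half-line below \<open>u\<close> or above \<open>v\<close>,
  membership forces the lower derivate at \<open>t\<close> to be at most \<open>u\<close> or the
  upper one to be at least \<open>v\<close>. The condition on \<open>t + h\<close> keeps
  \<open>f\<close> from being evaluated outside \<open>{a..b}\<close>, where nothing is known about
  it.\<close>

definition quotient_cluster :: "real \<Rightarrow> real \<Rightarrow> (real \<Rightarrow> real) \<Rightarrow> real set \<Rightarrow> real set"
  where "quotient_cluster a b f T = {t \<in> {a<..<b}.
    \<forall>n::nat. \<exists>h. h \<noteq> 0 \<and> \<bar>h\<bar> < 1 / Suc n \<and> t + h \<in> {a<..<b} \<and> (f (t + h) - f t) / h \<in> T}"

text \<open>For a fixed nonzero \<open>h\<close> the quotient is continuous in \<open>t\<close>, so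
  the points where it lies in \<open>T\<close> form an open set. The union over uncountably many
  \<open>h\<close> stays open, and only the countable index \<open>n\<close> is intersected.\<close>

lemma borel_quotient_cluster:
  assumes cont: "continuous_on {a..b} f" and T: "open T"
  shows "quotient_cluster a b f T \<in> sets borel"
proof -
  define W where "W h = {t. t \<in> {a<..<b} \<and> t + h \<in> {a<..<b}} \<inter> (\<lambda>t. (f (t + h) - f t) / h) -` T" for h
  have "open (W h)" if "h \<noteq> 0" for h
    unfolding W_def
  proof (rule continuous_open_preimage[OF _ _ T])
    have eq: "{t. t \<in> {a<..<b} \<and> t + h \<in> {a<..<b}} = {a<..<b} \<inter> {a - h<..<b - h}" by auto
    show "open {t. t \<in> {a<..<b} \<and> t + h \<in> {a<..<b}}" unfolding eq by auto
    have "continuous_on {t. t \<in> {a<..<b} \<and> t + h \<in> {a<..<b}} (\<lambda>t. f (t + h))"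
      by (rule continuous_on_compose2[OF cont]) (auto intro!: continuous_intros)
    moreover have "continuous_on {t. t \<in> {a<..<b} \<and> t + h \<in> {a<..<b}} f"
      by (rule continuous_on_subset[OF cont]) auto
    ultimately show "continuous_on {t. t \<in> {a<..<b} \<and> t + h \<in> {a<..<b}} (\<lambda>t. (f (t + h) - f t) / h)"
      using that by (intro continuous_intros) auto
  qed
  then have "open (\<Union>h\<in>{h. h \<noteq> 0 \<and> \<bar>h\<bar> < 1 / real (Suc n)}. W h)" for n :: nat
    by (intro open_UN) auto
  moreover have "quotient_cluster a b f T =
    {a<..<b} \<inter> (\<Inter>n::nat. \<Union>h\<in>{h. h \<noteq> 0 \<and> \<bar>h\<bar> < 1 / real (Suc n)}. W h)"
    by (fastforce simp: quotient_cluster_def W_def)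
  ultimately show ?thesis by auto
qed

lemma quotient_cluster_interval:
  assumes "t \<in> quotient_cluster a b f T" "d > 0"
  obtains l r where "l < r" "l \<le> t" "t \<le> r" "r - l < d" "(f r - f l) / (r - l) \<in> T"
proof -
  obtain n :: nat where n: "1 / Suc n < d" using nat_approx_posE[OF \<open>d > 0\<close>] by blast
  obtain h where h: "h \<noteq> 0" "\<bar>h\<bar> < 1 / Suc n" "(f (t + h) - f t) / h \<in> T"
    using assms(1) unfolding quotient_cluster_def by blast
  show thesis
  proof (cases "h > 0")
    case True
    then show thesis using that[of t "t + h"] h n by auto
  next
    case False
    have "(f t - f (t + h)) / (t - (t + h)) = (f (t + h) - f t) / h"
      by (simp add: divide_simps)
    then show thesis using that[of "t + h" t] False h n by auto
  qed
qed

lemma not_quotient_cluster: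
  assumes "t \<notin> quotient_cluster a b f T" "t \<in> {a<..<b}"
  shows "\<forall>\<^sub>F h in at 0. (f (t + h) - f t) / h \<notin> T"
proof -
  obtain n :: nat where n: "\<And>h. h \<noteq> 0 \<Longrightarrow> \<bar>h\<bar> < 1 / Suc n \<Longrightarrow> t + h \<in> {a<..<b} \<Longrightarrow> (f (t + h) - f t) / h \<notin> T"
    using assms unfolding quotient_cluster_def by blast
  show ?thesis
    unfolding eventually_at
  proof (intro exI[of _ "min (1 / Suc n) (min (t - a) (b - t))"] conjI ballI impI)
    show "0 < min (1 / Suc n) (min (t - a) (b - t))" using assms(2) by auto
    fix h :: real assume "h \<noteq> 0 \<and> dist h 0 < min (1 / Suc n) (min (t - a) (b - t))"
    then have "h \<noteq> 0" "\<bar>h\<bar> < 1 / Suc n" "\<bar>h\<bar> < t - a" "\<bar>h\<bar> < b - t" by (simp_all add: dist_real_def)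
    moreover from this have "t + h \<in> {a<..<b}" unfolding greaterThanLessThan_iff by linarith
    ultimately show "(f (t + h) - f t) / h \<notin> T" by (intro n)
  qed
qed

text \<open>Quotients converge at \<open>t\<close> if they are eventually bounded and do not
  oscillate across any pair of rationals \<open>u < v\<close>. Failure of the first is the
  intersection of clusters over all bounds \<open>M\<close>, failure of the second a union over
  countably many pairs; each is null by one of the two covering arguments.\<close>

lemma abs_continuous_on_AE_differentiable:
  assumes ac: "abs_continuous_on a b f"
  shows "AE t in lebesgue. t \<in> {a<..<b} \<longrightarrow> f field_differentiable (at t)"
proof -
  note cont = abs_continuous_on_imp_continuous_on[OF ac]
  have sub: "quotient_cluster a b f T \<subseteq> {a<..<b}" for T
    by (auto simp: quotient_cluster_def)
  have osc: "negligible (quotient_cluster a b f {..<u} \<inter> quotient_cluster a b f {v<..})" (is "negligible ?E")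
    if "u < v" for u v
  proof -
    have Em: "?E \<in> lmeasurable"
    proof (rule fmeasurableI2[of "{a<..<b}"])
      show "?E \<subseteq> {a<..<b}" using sub by blast
      show "?E \<in> sets lebesgue"
        by (intro sets.Int sets_completionI_sets) (simp_all add: borel_quotient_cluster[OF cont])
    qed simp
    have "measure lebesgue ?E = 0"
    proof (rule abs_continuous_ratio_null[OF ac Em _ \<open>u < v\<close>])
      fix x d :: real assume x: "x \<in> ?E" and d: "d > 0"
      obtain l r where "l < r" "l \<le> x" "x \<le> r" "r - l < d" "(f r - f l) / (r - l) \<in> {..<u}"
        using quotient_cluster_interval[of x a b f "{..<u}" d] x d by blast
      then show "\<exists>l r. l < r \<and> l \<le> x \<and> x \<le> r \<and> r - l < d \<and> f r - f l < u * (r - l)"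
        by (intro exI[of _ l] exI[of _ r]) (simp add: pos_divide_less_eq)
      obtain l r where "l < r" "l \<le> x" "x \<le> r" "r - l < d" "(f r - f l) / (r - l) \<in> {v<..}"
        using quotient_cluster_interval[of x a b f "{v<..}" d] x d by blast
      then show "\<exists>l r. l < r \<and> l \<le> x \<and> x \<le> r \<and> r - l < d \<and> v * (r - l) < f r - f l"
        by (intro exI[of _ l] exI[of _ r]) (simp add: pos_less_divide_eq)
    qed (use sub in blast)
    then show ?thesis using Em by (simp add: negligible_iff_measure)
  qed
  have inf: "negligible (\<Inter>M::nat. quotient_cluster a b f {y. real M < \<bar>y\<bar>})" (is "negligible ?E")
  proof (rule abs_continuous_infinite_ratio_null[OF ac])
    have "open {y :: real. real M < \<bar>y\<bar>}" for M :: nat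
      by (intro open_Collect_less continuous_intros)
    then have "?E \<in> sets lebesgue"
      by (intro sets.countable_INT image_subsetI sets_completionI_sets)
         (simp_all add: borel_quotient_cluster[OF cont])
    then show "?E \<in> lmeasurable"
      using sub by (intro fmeasurableI2[of "{a<..<b}" lebesgue ?E]) auto
    show "?E \<subseteq> {a<..<b}" using sub by blast
    fix x d M :: real assume x: "x \<in> ?E" and d: "d > 0"
    obtain N :: nat where N: "M \<le> real N" using real_arch_simple by blast
    obtain l r where lr: "l < r" "l \<le> x" "x \<le> r" "r - l < d" "(f r - f l) / (r - l) \<in> {y. real N < \<bar>y\<bar>}"
      using quotient_cluster_interval[of x a b f "{y. real N < \<bar>y\<bar>}" d] x d by blast
    then have "M < \<bar>f r - f l\<bar> / (r - l)" using N by simp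
    then show "\<exists>l r. l < r \<and> l \<le> x \<and> x \<le> r \<and> r - l < d \<and> M * (r - l) < \<bar>f r - f l\<bar>"
      using lr by (intro exI[of _ l] exI[of _ r]) (simp add: pos_less_divide_eq)
  qed
  let ?P = "{(u, v). u \<in> \<rat> \<and> v \<in> \<rat> \<and> u < v} :: (real \<times> real) set"
  let ?O = "\<lambda>(u, v). quotient_cluster a b f {..<u} \<inter> quotient_cluster a b f {v<..}"
  let ?B = "(\<Union>p\<in>?P. ?O p) \<union> (\<Inter>M::nat. quotient_cluster a b f {y. real M < \<bar>y\<bar>})"
  have "countable ?P"
    by (rule countable_subset[of _ "\<rat> \<times> \<rat>"]) (auto simp: countable_rat)
  then have "negligible (\<Union>p\<in>?P. ?O p)"
    by (intro negligible_countable_Union) (use osc in auto)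
  then have "negligible ?B" using inf by (rule negligible_Un)
  then have "?B \<in> null_sets lebesgue" by (simp add: negligible_iff_null_sets)
  then have "AE t in lebesgue. t \<notin> ?B" by (rule AE_not_in)
  then show ?thesis
  proof eventually_elim
    case (elim t)
    show ?case
    proof
      assume t: "t \<in> {a<..<b}"
      let ?q = "\<lambda>h. (f (t + h) - f t) / h"
      obtain M :: nat where "t \<notin> quotient_cluster a b f {y. real M < \<bar>y\<bar>}" using elim by auto
      from not_quotient_cluster[OF this t] have "\<forall>\<^sub>F h in at 0. \<bar>?q h\<bar> \<le> real M"
        by eventually_elim auto
      moreover have "(\<forall>\<^sub>F h in at 0. u \<le> ?q h) \<or> (\<forall>\<^sub>F h in at 0. ?q h \<le> v)"
        if uv: "u \<in> \<rat>" "v \<in> \<rat>" "u < v" for u v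
      proof -
        have "t \<notin> ?O (u, v)" using elim uv by blast
        then consider "t \<notin> quotient_cluster a b f {..<u}" | "t \<notin> quotient_cluster a b f {v<..}" by auto
        then show ?thesis
        proof cases
          case 1
          from not_quotient_cluster[OF this t] show ?thesis by (simp add: not_less)
        next
          case 2
          from not_quotient_cluster[OF this t] show ?thesis by (simp add: not_less)
        qed
      qed
      ultimately obtain L where "(?q \<longlongrightarrow> L) (at 0)"
        using tendsto_if_no_rational_oscillation[of "at 0" ?q "real M"] by auto
      then show "f field_differentiable (at t)"
        unfolding field_differentiable_def DERIV_def by blast
    qed
  qed
qed

text \<open>Intervals with rational endpoints exhaust \<open>S\<close>, so only countably many
  exceptional null sets have to be united.\<close>

lemma AE_differentiable_on_open:
  fixes S :: "real set"
  assumes S: "open S"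
    and ac: "\<And>a b. a \<le> b \<Longrightarrow> {a..b} \<subseteq> S \<Longrightarrow> abs_continuous_on a b f"
  shows "AE t in lebesgue. t \<in> S \<longrightarrow> f field_differentiable (at t)"
proof -
  let ?P = "{(a, b). a \<in> \<rat> \<and> b \<in> \<rat> \<and> a \<le> b \<and> {a..b} \<subseteq> S} :: (real \<times> real) set"
  have "countable ?P"
    by (rule countable_subset[of _ "\<rat> \<times> \<rat>"]) (auto simp: countable_rat)
  then have "AE t in lebesgue. \<forall>(a, b)\<in>?P. t \<in> {a<..<b} \<longrightarrow> f field_differentiable (at t)"
  proof (subst AE_ball_countable, assumption, clarify)
    fix a b :: real assume "a \<le> b" "{a..b} \<subseteq> S"
    then show "AE t in lebesgue. t \<in> {a<..<b} \<longrightarrow> f field_differentiable (at t)"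
      by (intro abs_continuous_on_AE_differentiable ac)
  qed
  then show ?thesis
  proof eventually_elim
    case (elim t)
    show ?case
    proof
      assume "t \<in> S"
      then obtain e where e: "e > 0" "ball t e \<subseteq> S" using S open_contains_ball by blast
      obtain a where a: "a \<in> \<rat>" "t - e < a" "a < t" using Rats_dense_in_real[of "t - e" t] e by auto
      obtain b where b: "b \<in> \<rat>" "t < b" "b < t + e" using Rats_dense_in_real[of t "t + e"] e by auto
      have "{a..b} \<subseteq> ball t e" using a b by (auto simp: dist_real_def)
      then have ab: "(a, b) \<in> ?P" using a b e by auto
      show "f field_differentiable (at t)" using bspec[OF elim ab] a b by auto
    qed
  qed
qed

section \<open>Decomposition of Lebesgue measure along parallel lines\<close>

lemma measurable_pi_reindex:
  fixes \<sigma> :: "'a::euclidean_space \<Rightarrow> 'b"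
  assumes \<sigma>: "bij_betw \<sigma> Basis B"
  shows "(\<lambda>f. \<Sum>b\<in>Basis. f (\<sigma> b) *\<^sub>R b) \<in> (\<Pi>\<^sub>M b\<in>B. (lborel :: real measure)) \<rightarrow>\<^sub>M (borel :: 'a measure)"
proof -
  have \<sigma>B: "\<sigma> b \<in> B" if "b \<in> Basis" for b using \<sigma> that by (auto simp: bij_betw_def)
  show ?thesis
    by (intro borel_measurable_sum borel_measurable_scaleR measurable_const)
       (use \<sigma>B in \<open>auto intro!: measurable_component_singleton[THEN measurable_compose]\<close>)
qed

text \<open>Product measures below are indexed by the vectors of a chosen basis instead of
  \<open>Basis\<close>. A bijection \<open>\<sigma>\<close> of the index sets transports one product
  to the other, because Lebesgue measure is determined by its values on boxes.\<close>

lemma lborel_pi_reindex: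
  fixes \<sigma> :: "'a::euclidean_space \<Rightarrow> 'b"
  assumes \<sigma>: "bij_betw \<sigma> Basis B"
  shows "distr (\<Pi>\<^sub>M b\<in>B. lborel) borel (\<lambda>f. \<Sum>b\<in>Basis. f (\<sigma> b) *\<^sub>R b) = (lborel :: 'a measure)"
proof (rule lborel_eqI[symmetric])
  interpret product_sigma_finite "\<lambda>_. lborel :: real measure" ..
  have finB: "finite B" using bij_betw_finite[OF \<sigma>] by simp
  note [measurable] = measurable_pi_reindex[OF \<sigma>]
  fix l u :: 'a assume lu: "\<And>b. b \<in> Basis \<Longrightarrow> l \<bullet> b \<le> u \<bullet> b"
  define \<tau> where "\<tau> = inv_into Basis \<sigma>"
  have \<tau>\<sigma>: "\<tau> (\<sigma> b) = b" if "b \<in> Basis" for b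
    using \<sigma> that by (simp add: \<tau>_def bij_betw_def)
  have eq: "(\<lambda>f. \<Sum>b\<in>Basis. f (\<sigma> b) *\<^sub>R b) -` box l u \<inter> space (\<Pi>\<^sub>M b\<in>B. lborel)
      = Pi\<^sub>E B (\<lambda>c. {l \<bullet> \<tau> c<..<u \<bullet> \<tau> c})" (is "?L = ?R")
  proof (intro set_eqI)
    fix f :: "'b \<Rightarrow> real"
    have "f \<in> ?L \<longleftrightarrow> f \<in> extensional B \<and> (\<forall>b\<in>Basis. f (\<sigma> b) \<in> {l \<bullet> b<..<u \<bullet> b})"
      by (auto simp: space_PiM PiE_def mem_box inner_sum_left inner_Basis if_distrib cong: if_cong)
    also have "\<dots> \<longleftrightarrow> f \<in> extensional B \<and> (\<forall>c\<in>\<sigma> ` Basis. f c \<in> {l \<bullet> \<tau> c<..<u \<bullet> \<tau> c})"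
      by (simp add: \<tau>\<sigma>)
    also have "\<sigma> ` Basis = B" using \<sigma> by (simp add: bij_betw_def)
    finally show "f \<in> ?L \<longleftrightarrow> f \<in> ?R" by (auto simp: PiE_def Pi_iff)
  qed
  have "emeasure (distr (\<Pi>\<^sub>M b\<in>B. lborel) borel (\<lambda>f. \<Sum>b\<in>Basis. f (\<sigma> b) *\<^sub>R b)) (box l u)
      = emeasure (\<Pi>\<^sub>M b\<in>B. lborel) (Pi\<^sub>E B (\<lambda>c. {l \<bullet> \<tau> c<..<u \<bullet> \<tau> c}))"
    by (subst emeasure_distr) (simp_all only: eq, auto)
  also have "\<dots> = (\<Prod>c\<in>B. emeasure lborel {l \<bullet> \<tau> c<..<u \<bullet> \<tau> c})"
    by (rule emeasure_PiM) (use finB in auto)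
  also have "\<dots> = (\<Prod>b\<in>Basis. emeasure lborel {l \<bullet> b<..<u \<bullet> b})"
    by (rule prod.reindex_bij_betw[OF \<sigma>, symmetric, THEN trans]) (simp add: \<tau>\<sigma>)
  also have "\<dots> = ennreal (\<Prod>b\<in>Basis. (u - l) \<bullet> b)"
    using lu by (simp add: prod_ennreal inner_diff_left)
  finally show "emeasure (distr (\<Pi>\<^sub>M b\<in>B. lborel) borel (\<lambda>f. \<Sum>b\<in>Basis. f (\<sigma> b) *\<^sub>R b)) (box l u)
      = ennreal (\<Prod>b\<in>Basis. (u - l) \<bullet> b)" .
qed simp

text \<open>Orthonormal vectors are independent and a hyperplane has codimension one, so its normal
  \<open>e\<close> completes the basis to one of the whole space.\<close>

lemma hyperplane_basis_props:
  fixes e :: "real^'n"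
  assumes e: "e \<in> sphere 0 1"
  shows "finite (hyperplane_basis e)" "e \<notin> hyperplane_basis e"
    "span (insert e (hyperplane_basis e)) = UNIV" "card (insert e (hyperplane_basis e)) = DIM(real^'n)"
    "\<And>b. b \<in> hyperplane_basis e \<Longrightarrow> e \<bullet> b = 0"
proof -
  let ?B = "hyperplane_basis e"
  have B: "pairwise orthogonal ?B" "\<forall>b\<in>?B. norm b = 1" "span ?B = {x. e \<bullet> x = 0}"
    using hyperplane_basis[of e] unfolding orthonormal_basis_of_def by auto
  have ee: "e \<bullet> e = 1" using e by (simp add: dot_square_norm)
  then have e0: "e \<noteq> 0" by auto
  have ind: "independent ?B"
    by (rule pairwise_orthogonal_independent[OF B(1)]) (use B(2) in auto)
  then show fin: "finite ?B" by (rule independent_imp_finite)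
  show "e \<bullet> b = 0" if "b \<in> ?B" for b using span_base[OF that] B(3) by auto
  then show nin: "e \<notin> ?B" using ee by auto
  have "card ?B = dim (span ?B)" using ind by (simp add: dim_eq_card_independent)
  also have "\<dots> = DIM(real^'n) - 1" unfolding B(3) by (rule dim_hyperplane[OF e0])
  finally show card: "card (insert e ?B) = DIM(real^'n)"
    using nin fin DIM_positive[where 'a="real^'n"] by simp
  have "e \<notin> span ?B" unfolding B(3) using ee by simp
  then have "independent (insert e ?B)" using ind by (simp add: independent_insert)
  then have "dim (insert e ?B) = DIM(real^'n)" using card by (simp add: dim_eq_card_independent)
  then show "span (insert e ?B) = UNIV" by (simp only: dim_eq_full)
qed

text \<open>Tonelli on the product over \<open>insert e (hyperplane_basis e)\<close>, with the
  coordinate along \<open>e\<close> innermost, shows that \<open>S\<close> is null in the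
  coordinates of that basis. The surjective linear map \<open>T\<close> sends a coordinate vector to
  the point it describes, and linear images of null sets are null, so no determinant has to be
  computed.\<close>

lemma AE_lborel_if_AE_lines:
  fixes e :: "real^'n"
  assumes e: "e \<in> sphere 0 1" and S: "S \<in> sets borel"
    and lines: "AE y in hyperplane_lborel e. AE t in lborel. y + t *\<^sub>R e \<notin> S"
  shows "AE x in lborel. x \<notin> S"
proof -
  let ?B = "hyperplane_basis e" and ?C = "insert e (hyperplane_basis e)"
  note B = hyperplane_basis_props[OF e]
  interpret product_sigma_finite "\<lambda>_. lborel :: real measure" ..
  have finC: "finite ?C" using B(1) by simp
  obtain \<sigma> where \<sigma>: "bij_betw \<sigma> (Basis :: (real^'n) set) ?C"
    using finite_same_card_bij[OF finite_Basis finC B(4)[symmetric]] by blast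
  define T where "T x = (\<Sum>b\<in>Basis. (x \<bullet> b) *\<^sub>R \<sigma> b)" for x :: "real^'n"
  have T: "linear T"
    unfolding T_def by (intro linearI) (simp_all add: inner_add_left scaleR_left_distrib sum.distrib scaleR_sum_right)
  have TB: "T b = \<sigma> b" if "b \<in> Basis" for b
    using that by (simp add: T_def inner_Basis if_distrib[of "\<lambda>z. z *\<^sub>R _"] cong: if_cong)
  have "?C \<subseteq> range T"
    using \<sigma> TB unfolding bij_betw_def by (metis image_cong image_mono subset_UNIV)
  then have "span ?C \<subseteq> range T"
    by (intro span_minimal linear_subspace_image T subspace_UNIV)
  then have surjT: "range T = UNIV" using B(3) by auto
  have [measurable]: "T \<in> borel_measurable borel"
    using T by (intro borel_measurable_continuous_onI linear_continuous_on linear_conv_bounded_linear[THEN iffD1])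
  define \<Phi> where "\<Phi> f = (\<Sum>b\<in>?C. f b *\<^sub>R b)" for f :: "real^'n \<Rightarrow> real"
  have [measurable]: "\<Phi> \<in> (\<Pi>\<^sub>M b\<in>?C. lborel) \<rightarrow>\<^sub>M borel"
    unfolding \<Phi>_def by measurable
  have \<phi>m: "(\<lambda>f. \<Sum>b\<in>?B. f b *\<^sub>R b) \<in> (\<Pi>\<^sub>M b\<in>?B. lborel) \<rightarrow>\<^sub>M (borel :: (real^'n) measure)"
    by measurable
  have "AE f in (\<Pi>\<^sub>M b\<in>?B. lborel). AE t in lborel. (\<Sum>b\<in>?B. f b *\<^sub>R b) + t *\<^sub>R e \<notin> S"
    using lines unfolding hyperplane_lborel_def by (rule AE_distrD[OF \<phi>m])
  moreover have "\<Phi> (f(e := t)) = (\<Sum>b\<in>?B. f b *\<^sub>R b) + t *\<^sub>R e" for f t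
  proof -
    have "(\<Sum>b\<in>?B. (f(e := t)) b *\<^sub>R b) = (\<Sum>b\<in>?B. f b *\<^sub>R b)"
      by (rule sum.cong) (use B(2) in auto)
    then show ?thesis using B(1,2) by (simp add: \<Phi>_def)
  qed
  ultimately have ae: "AE f in (\<Pi>\<^sub>M b\<in>?B. lborel). AE t in lborel. \<Phi> (f(e := t)) \<notin> S" by simp
  have Sm: "\<Phi> -` S \<inter> space (\<Pi>\<^sub>M b\<in>?C. lborel) \<in> sets (\<Pi>\<^sub>M b\<in>?C. lborel)"
    using S by measurable
  have TS: "T -` S \<in> sets borel" using S measurable_sets_borel[of T borel S] by simp
  have "emeasure (\<Pi>\<^sub>M b\<in>?C. lborel) (\<Phi> -` S \<inter> space (\<Pi>\<^sub>M b\<in>?C. lborel))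
      = (\<integral>\<^sup>+f. indicator S (\<Phi> f) \<partial>(\<Pi>\<^sub>M b\<in>?C. lborel))"
    by (subst nn_integral_indicator[OF Sm, symmetric]) (auto intro!: nn_integral_cong simp: indicator_def)
  also have "\<dots> = (\<integral>\<^sup>+f. (\<integral>\<^sup>+t. indicator S (\<Phi> (f(e := t))) \<partial>lborel) \<partial>(\<Pi>\<^sub>M b\<in>?B. lborel))"
    by (rule product_nn_integral_insert[OF B(1,2)]) (use S in measurable)
  also have "\<dots> = (\<integral>\<^sup>+f. 0 \<partial>(\<Pi>\<^sub>M b\<in>?B. (lborel :: real measure)))"
  proof (rule nn_integral_cong_AE)
    show "AE f in (\<Pi>\<^sub>M b\<in>?B. lborel). (\<integral>\<^sup>+t. indicator S (\<Phi> (f(e := t))) \<partial>lborel) = 0"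
      using ae
    proof eventually_elim
      case (elim f)
      have "(\<integral>\<^sup>+t. indicator S (\<Phi> (f(e := t))) \<partial>lborel) = (\<integral>\<^sup>+t. 0 \<partial>(lborel :: real measure))"
        by (rule nn_integral_cong_AE) (use elim in eventually_elim, simp)
      then show ?case by simp
    qed
  qed
  finally have "emeasure (\<Pi>\<^sub>M b\<in>?C. lborel) (\<Phi> -` S \<inter> space (\<Pi>\<^sub>M b\<in>?C. lborel)) = 0" by simp
  moreover have "\<Phi> f = T (\<Sum>b\<in>Basis. f (\<sigma> b) *\<^sub>R b)" for f
  proof -
    have "T (\<Sum>b\<in>Basis. f (\<sigma> b) *\<^sub>R b) = (\<Sum>b\<in>Basis. f (\<sigma> b) *\<^sub>R \<sigma> b)"
      using T by (simp add: linear_sum linear_scale TB)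
    also have "\<dots> = \<Phi> f" unfolding \<Phi>_def by (rule sum.reindex_bij_betw[OF \<sigma>])
    finally show ?thesis by simp
  qed
  then have "(\<lambda>f. \<Sum>b\<in>Basis. f (\<sigma> b) *\<^sub>R b) -` T -` S = \<Phi> -` S"
    by (simp add: vimage_def)
  ultimately have "emeasure (distr (\<Pi>\<^sub>M b\<in>?C. lborel) borel (\<lambda>f. \<Sum>b\<in>Basis. f (\<sigma> b) *\<^sub>R b)) (T -` S) = 0"
    by (simp add: emeasure_distr[OF measurable_pi_reindex[OF \<sigma>] TS])
  then have "emeasure lborel (T -` S) = 0" unfolding lborel_pi_reindex[OF \<sigma>] .
  moreover note TS
  ultimately have "negligible (T -` S)"
    by (simp add: negligible_iff_null_sets null_sets_def emeasure_completion)
  then have "negligible (T ` (T -` S))"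
    by (rule negligible_differentiable_image_negligible[OF order_refl])
       (use T in \<open>simp add: linear_imp_differentiable_on\<close>)
  also have "T ` (T -` S) = S" using surjT by (simp add: surj_image_vimage_eq)
  finally have "S \<in> null_sets lborel"
    using S by (simp add: negligible_iff_null_sets null_sets_def)
  then show ?thesis by (rule AE_not_in)
qed

text \<open>Restricting the increments to the rationals makes the set of points at which the quotients of
  a Borel function are Cauchy a Borel set; for functions continuous along the line nothing is
  lost.\<close>

definition rational_quotients_Cauchy :: "(real \<Rightarrow> real) \<Rightarrow> bool"
  where "rational_quotients_Cauchy k \<longleftrightarrow> (\<forall>m::nat. \<exists>n::nat. \<forall>p q :: rat.
    p \<noteq> 0 \<and> q \<noteq> 0 \<and> \<bar>of_rat p\<bar> < 1 / real (Suc n) \<and> \<bar>of_rat q\<bar> < 1 / real (Suc n) \<longrightarrow>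
    \<bar>(k (of_rat p) - k 0) / of_rat p - (k (of_rat q) - k 0) / of_rat q\<bar> \<le> 1 / real (Suc m))"

section \<open>A Borel criterion for differentiability along a line\<close>

lemma field_differentiable_imp_rational_quotients_Cauchy:
  assumes "k field_differentiable (at 0)"
  shows "rational_quotients_Cauchy k"
  unfolding rational_quotients_Cauchy_def
proof
  fix m :: nat
  obtain L where "((\<lambda>h. (k h - k 0) / h) \<longlongrightarrow> L) (at 0)"
    using assms unfolding field_differentiable_def DERIV_def by auto
  then have "\<forall>\<^sub>F h in at 0. dist ((k h - k 0) / h) L < 1 / (2 * real (Suc m))"
    by (rule tendstoD) simp
  then obtain d where d: "d > 0"
    "\<And>h. h \<noteq> 0 \<Longrightarrow> \<bar>h\<bar> < d \<Longrightarrow> \<bar>(k h - k 0) / h - L\<bar> < 1 / (2 * real (Suc m))"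
    unfolding eventually_at dist_real_def by auto
  obtain n :: nat where n: "1 / Suc n < d" using nat_approx_posE[OF \<open>d > 0\<close>] by blast
  have "\<bar>(k (of_rat p) - k 0) / of_rat p - (k (of_rat q) - k 0) / of_rat q\<bar> \<le> 1 / real (Suc m)"
    if "p \<noteq> 0 \<and> q \<noteq> 0 \<and> \<bar>of_rat p\<bar> < 1 / real (Suc n) \<and> \<bar>of_rat q\<bar> < 1 / real (Suc n)" for p q :: rat
  proof -
    have "\<bar>(k (of_rat p) - k 0) / of_rat p - L\<bar> < 1 / (2 * real (Suc m))"
      "\<bar>(k (of_rat q) - k 0) / of_rat q - L\<bar> < 1 / (2 * real (Suc m))"
      using that n by (intro d(2); simp)+
    moreover have "1 / (2 * real (Suc m)) + 1 / (2 * real (Suc m)) = 1 / real (Suc m)"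
      by (simp add: field_simps)
    moreover have "\<bar>a - b\<bar> \<le> r" if "\<bar>a - L\<bar> < c" "\<bar>b - L\<bar> < c" "c + c = r" for a b c r :: real
      using that by linarith
    ultimately show ?thesis by blast
  qed
  then show "\<exists>n::nat. \<forall>p q :: rat.
    p \<noteq> 0 \<and> q \<noteq> 0 \<and> \<bar>of_rat p\<bar> < 1 / real (Suc n) \<and> \<bar>of_rat q\<bar> < 1 / real (Suc n) \<longrightarrow>
    \<bar>(k (of_rat p) - k 0) / of_rat p - (k (of_rat q) - k 0) / of_rat q\<bar> \<le> 1 / real (Suc m)"
    by blast
qed

text \<open>The quotients at the rational points \<open>1 / (j + 1)\<close> are Cauchy and define
  the limit \<open>L\<close>. All small rational increments then have quotients close to
  \<open>L\<close>, and continuity near 0 with density of the rationals passes the bound on to real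
  increments.\<close>

lemma rational_quotients_Cauchy_imp_field_differentiable:
  assumes k: "rational_quotients_Cauchy k" and d: "d > 0" and cont: "continuous_on {- d<..<d} k"
  shows "k field_differentiable (at 0)"
proof -
  let ?Q = "\<lambda>h. (k h - k 0) / h"
  have C: "\<exists>n::nat. \<forall>p q. p \<in> \<rat> \<longrightarrow> q \<in> \<rat> \<longrightarrow> p \<noteq> 0 \<longrightarrow> q \<noteq> 0 \<longrightarrow> \<bar>p\<bar> < 1 / real (Suc n) \<longrightarrow>
      \<bar>q\<bar> < 1 / real (Suc n) \<longrightarrow> \<bar>?Q p - ?Q q\<bar> \<le> 1 / real (Suc m)" for m :: nat
  proof -
    obtain n :: nat where n: "\<forall>p q :: rat.
      p \<noteq> 0 \<and> q \<noteq> 0 \<and> \<bar>of_rat p\<bar> < 1 / real (Suc n) \<and> \<bar>of_rat q\<bar> < 1 / real (Suc n) \<longrightarrow>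
      \<bar>?Q (of_rat p) - ?Q (of_rat q)\<bar> \<le> 1 / real (Suc m)"
      using k unfolding rational_quotients_Cauchy_def by blast
    show ?thesis
      by (intro exI[of _ n] allI impI, elim Rats_cases) (use n in auto)
  qed
  define s where "s j = 1 / real (Suc j)" for j
  have s: "s j \<in> \<rat>" "s j \<noteq> 0" for j by (auto simp: s_def)
  have s_less: "\<bar>s j\<bar> < 1 / real (Suc n)" if "n < j" for n j
    using that by (simp add: s_def frac_less2)
  have "Cauchy (\<lambda>j. ?Q (s j))"
  proof (rule CauchyI)
    fix \<epsilon> :: real assume "\<epsilon> > 0"
    then obtain m :: nat where m: "1 / Suc m < \<epsilon>" using nat_approx_posE by blast
    obtain n :: nat where n: "\<forall>p q. p \<in> \<rat> \<longrightarrow> q \<in> \<rat> \<longrightarrow> p \<noteq> 0 \<longrightarrow> q \<noteq> 0 \<longrightarrow> \<bar>p\<bar> < 1 / real (Suc n) \<longrightarrow>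
      \<bar>q\<bar> < 1 / real (Suc n) \<longrightarrow> \<bar>?Q p - ?Q q\<bar> \<le> 1 / real (Suc m)" using C by blast
    have "norm (?Q (s i) - ?Q (s j)) < \<epsilon>" if "i \<ge> Suc n" "j \<ge> Suc n" for i j
    proof -
      have "\<bar>?Q (s i) - ?Q (s j)\<bar> \<le> 1 / real (Suc m)"
        using n s s_less[of n i] s_less[of n j] that by simp
      then show ?thesis using m by (simp only: real_norm_def)
    qed
    then show "\<exists>M. \<forall>i\<ge>M. \<forall>j\<ge>M. norm (?Q (s i) - ?Q (s j)) < \<epsilon>" by blast
  qed
  then obtain L where L: "(\<lambda>j. ?Q (s j)) \<longlonglongrightarrow> L"
    using Cauchy_convergent_iff convergent_def by blast
  have "(?Q \<longlongrightarrow> L) (at 0)"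
  proof (rule tendstoI)
    fix \<epsilon> :: real assume "\<epsilon> > 0"
    then obtain m :: nat where m: "1 / Suc m < \<epsilon>" using nat_approx_posE by blast
    obtain n :: nat where n: "\<forall>p q. p \<in> \<rat> \<longrightarrow> q \<in> \<rat> \<longrightarrow> p \<noteq> 0 \<longrightarrow> q \<noteq> 0 \<longrightarrow> \<bar>p\<bar> < 1 / real (Suc n) \<longrightarrow>
      \<bar>q\<bar> < 1 / real (Suc n) \<longrightarrow> \<bar>?Q p - ?Q q\<bar> \<le> 1 / real (Suc m)" using C by blast
    have rat: "\<bar>?Q p - L\<bar> \<le> 1 / real (Suc m)" if p: "p \<in> \<rat>" "p \<noteq> 0" "\<bar>p\<bar> < 1 / real (Suc n)" for p
    proof (rule tendsto_upperbound)
      show "(\<lambda>j. \<bar>?Q p - ?Q (s j)\<bar>) \<longlonglongrightarrow> \<bar>?Q p - L\<bar>" by (intro tendsto_intros L)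
      show "\<forall>\<^sub>F j in sequentially. \<bar>?Q p - ?Q (s j)\<bar> \<le> 1 / real (Suc m)"
        using eventually_gt_at_top[of n]
      proof eventually_elim
        case (elim j)
        then show ?case using n p s s_less[OF elim] by blast
      qed
    qed simp
    \<comment> \<open>At \<open>h \<noteq> 0\<close> the quotient is continuous, so a violated bound
      persists in a neighbourhood and thus at a rational point, contradicting
      \<open>rat\<close>.\<close>
    have real: "\<bar>?Q h - L\<bar> \<le> 1 / real (Suc m)" if h: "h \<noteq> 0" "\<bar>h\<bar> < 1 / real (Suc n)" "\<bar>h\<bar> < d" for h
    proof (rule ccontr)
      assume "\<not> \<bar>?Q h - L\<bar> \<le> 1 / real (Suc m)"
      then have "1 / real (Suc m) < \<bar>?Q h - L\<bar>" by simp
      moreover have "isCont k h"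
        using h(3) continuous_on_interior[OF cont, of h] by (simp add: abs_less_iff interior_open)
      then have "((\<lambda>y. \<bar>?Q y - L\<bar>) \<longlongrightarrow> \<bar>?Q h - L\<bar>) (nhds h)"
        using h(1) by (intro tendsto_intros filterlim_ident) (auto simp: tendsto_at_iff_tendsto_nhds isCont_def)
      ultimately have "\<forall>\<^sub>F y in nhds h. 1 / real (Suc m) < \<bar>?Q y - L\<bar>"
        by (intro order_tendstoD(1))
      moreover have "((\<lambda>y. \<bar>y\<bar>) \<longlongrightarrow> \<bar>h\<bar>) (nhds h)" by (intro tendsto_intros filterlim_ident)
      then have "\<forall>\<^sub>F y in nhds h. \<bar>y\<bar> < 1 / real (Suc n)"
        using h(2) by (rule order_tendstoD(2))
      moreover have "\<forall>\<^sub>F y in nhds h. y \<noteq> 0"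
        using h(1) by (intro t1_space_nhds)
      ultimately have "\<forall>\<^sub>F y in nhds h. y \<noteq> 0 \<and> \<bar>y\<bar> < 1 / real (Suc n) \<and> 1 / real (Suc m) < \<bar>?Q y - L\<bar>"
        by eventually_elim blast
      then obtain \<delta> where \<delta>: "\<delta> > 0"
        "\<And>y. dist y h < \<delta> \<Longrightarrow> y \<noteq> 0 \<and> \<bar>y\<bar> < 1 / real (Suc n) \<and> 1 / real (Suc m) < \<bar>?Q y - L\<bar>"
        unfolding eventually_nhds_metric by blast
      obtain p where p: "p \<in> \<rat>" "h < p" "p < h + \<delta>" using Rats_dense_in_real[of h "h + \<delta>"] \<delta>(1) by auto
      then have "dist p h < \<delta>" by (simp add: dist_real_def)
      then show False using \<delta>(2)[of p] rat[OF p(1)] by (simp add: not_less[symmetric])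
    qed
    show "\<forall>\<^sub>F h in at 0. dist (?Q h) L < \<epsilon>"
      unfolding eventually_at
    proof (intro exI[of _ "min (1 / real (Suc n)) d"] conjI ballI impI)
      show "0 < min (1 / real (Suc n)) d" using d by simp
      fix h :: real assume "h \<noteq> 0 \<and> dist h 0 < min (1 / real (Suc n)) d"
      then have "\<bar>?Q h - L\<bar> \<le> 1 / real (Suc m)" by (intro real) (simp_all add: dist_real_def)
      then show "dist (?Q h) L < \<epsilon>" using m by (simp only: dist_real_def)
    qed
  qed
  then show ?thesis unfolding field_differentiable_def DERIV_def by auto
qed

text \<open>All quantifiers in the criterion range over countable types, so the set arises from
  Borel sets by countable operations.\<close>

lemma measurable_rational_quotients_Cauchy:
  fixes e :: "'a::euclidean_space"
  assumes [measurable]: "G \<in> borel_measurable borel"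
  shows "{x. rational_quotients_Cauchy (\<lambda>s. G (x + s *\<^sub>R e))} \<in> sets borel"
  unfolding rational_quotients_Cauchy_def by measurable

lemma field_differentiable_cong_ev:
  assumes "\<forall>\<^sub>F y in nhds x. f y = g y"
  shows "f field_differentiable (at x) \<longleftrightarrow> g field_differentiable (at x)"
  unfolding field_differentiable_def using DERIV_cong_ev[OF refl assms refl] by blast

text \<open>Two Borel null sets are removed: \<open>S\<close>, the points of \<open>\<Omega>\<close>
  whose rational quotients are not Cauchy, and \<open>Z\<close>, which contains all points on bad
  lines. Off \<open>Z\<close> the function is continuous along the line near the point, so that off
  \<open>S\<close> as well the quotient criterion yields a derivative.\<close>

lemma ACL_AE_differentiable:
  fixes e :: "real^'n"
  assumes g: "g \<in> ACL \<Omega>" and \<Omega>: "open \<Omega>" and e: "e \<in> sphere 0 1"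
  shows "AE x in lebesgue. x \<in> \<Omega> \<longrightarrow> (\<lambda>t. g (x + t *\<^sub>R e)) field_differentiable (at 0)"
proof -
  have ee: "e \<bullet> e = 1" using e by (simp add: dot_square_norm)
  \<comment> \<open>\<open>g\<close> is Borel only on \<open>\<Omega>\<close>. Extension by zero
    makes the quotient criterion a Borel condition on the whole space and changes nothing near a
    point of the open set \<open>\<Omega>\<close>.\<close>
  define G where "G x = indicator \<Omega> x *\<^sub>R g x" for x
  have G: "G x = g x" if "x \<in> \<Omega>" for x using that by (simp add: G_def)
  have Gm: "G \<in> borel_measurable borel"
    using g \<Omega> unfolding ACL_def G_def by (simp add: borel_measurable_restrict_space_iff)
  define good where "good y \<longleftrightarrow> (\<forall>a b. a \<le> b \<and> (\<forall>t\<in>{a..b}. y + t *\<^sub>R e \<in> \<Omega>) \<longrightarrow>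
       abs_continuous_on a b (\<lambda>t. g (y + t *\<^sub>R e)))" for y
  have "AE y in hyperplane_lborel e. good y" using g e unfolding ACL_def good_def by blast
  \<comment> \<open>The set of bad lines may fail to be measurable; a measurable null superset
    replaces it, so that its preimage \<open>Z\<close> is Borel.\<close>
  then obtain N where N: "{y \<in> space (hyperplane_lborel e). \<not> good y} \<subseteq> N"
      "emeasure (hyperplane_lborel e) N = 0" "N \<in> sets (hyperplane_lborel e)"
    by (rule AE_E)
  have goodN: "good y" if "y \<notin> N" for y
    using N(1) that by (auto simp: hyperplane_lborel_def)
  have Nb: "N \<in> sets borel" using N(3) by (simp add: hyperplane_lborel_def)
  have AE_N: "AE y in hyperplane_lborel e. y \<notin> N"
    by (rule AE_not_in) (use N in \<open>simp add: null_sets_def\<close>)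
  \<comment> \<open>The hyperplane measure lives on the whole space. Its concentration on the
    hyperplane ensures that projecting a point of the line through \<open>y\<close> gives back
    \<open>y\<close>.\<close>
  have AE_perp: "AE y in hyperplane_lborel e. y \<bullet> e = 0"
  proof -
    have "(\<Sum>b\<in>hyperplane_basis e. f b *\<^sub>R b) \<bullet> e = 0" for f :: "real^'n \<Rightarrow> real"
      using hyperplane_basis_props(5)[OF e] by (simp add: inner_commute[of _ e] inner_sum_right)
    then show ?thesis
      unfolding hyperplane_lborel_def by (subst AE_distr_iff) auto
  qed
  have open_line: "open {t. y + t *\<^sub>R e \<in> \<Omega>}" for y
    using open_vimage[OF \<Omega>, of "\<lambda>t. y + t *\<^sub>R e"] by (simp add: vimage_def continuous_intros)
  have line_eq: "\<forall>\<^sub>F s in nhds 0. g ((y + t *\<^sub>R e) + s *\<^sub>R e) = G ((y + t *\<^sub>R e) + s *\<^sub>R e)"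
    if "y + t *\<^sub>R e \<in> \<Omega>" for y t
  proof -
    have "\<forall>\<^sub>F s in nhds 0. s \<in> {s. (y + t *\<^sub>R e) + s *\<^sub>R e \<in> \<Omega>}"
      using that by (intro eventually_nhds_in_open open_line) auto
    then show ?thesis by eventually_elim (simp add: G)
  qed
  define S where "S = \<Omega> - {x. rational_quotients_Cauchy (\<lambda>s. G (x + s *\<^sub>R e))}"
  have "AE x in lborel. x \<notin> S"
  proof (rule AE_lborel_if_AE_lines[OF e])
    show "S \<in> sets borel"
      unfolding S_def using measurable_rational_quotients_Cauchy[OF Gm] \<Omega> by (intro sets.Diff) auto
    show "AE y in hyperplane_lborel e. AE t in lborel. y + t *\<^sub>R e \<notin> S"
      using AE_N
    proof eventually_elim
      case (elim y)
      have "abs_continuous_on a b (\<lambda>t. g (y + t *\<^sub>R e))" if "a \<le> b" "{a..b} \<subseteq> {t. y + t *\<^sub>R e \<in> \<Omega>}" for a b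
        using goodN[OF elim] that unfolding good_def by blast
      from AE_differentiable_on_open[OF open_line this]
      have "AE t in lborel. t \<in> {t. y + t *\<^sub>R e \<in> \<Omega>} \<longrightarrow> (\<lambda>t. g (y + t *\<^sub>R e)) field_differentiable (at t)"
        by (simp add: AE_completion_iff)
      then show ?case
      proof eventually_elim
        case (elim t)
        show ?case
        proof
          assume "y + t *\<^sub>R e \<in> S"
          then have t: "y + t *\<^sub>R e \<in> \<Omega>" and bad: "\<not> rational_quotients_Cauchy (\<lambda>s. G ((y + t *\<^sub>R e) + s *\<^sub>R e))"
            by (auto simp: S_def)
          have "(\<lambda>t. g (y + t *\<^sub>R e)) field_differentiable (at (0 + t))" using elim t by simp
          then have "(\<lambda>s. g (y + (s + t) *\<^sub>R e)) field_differentiable (at 0)"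
            unfolding field_differentiable_def DERIV_shift .
          then have "(\<lambda>s. g ((y + t *\<^sub>R e) + s *\<^sub>R e)) field_differentiable (at 0)"
            by (simp add: scaleR_left_distrib add_ac)
          then have "(\<lambda>s. G ((y + t *\<^sub>R e) + s *\<^sub>R e)) field_differentiable (at 0)"
            using field_differentiable_cong_ev[OF line_eq[OF t]] by blast
          then show False using field_differentiable_imp_rational_quotients_Cauchy bad by blast
        qed
      qed
    qed
  qed
  moreover
  define Z where "Z = (\<lambda>x. x - (x \<bullet> e) *\<^sub>R e) -` N"
  have "AE x in lborel. x \<notin> Z"
  proof (rule AE_lborel_if_AE_lines[OF e])
    show "Z \<in> sets borel"
      unfolding Z_def using measurable_sets_borel[of "\<lambda>x. x - (x \<bullet> e) *\<^sub>R e" borel N] Nb by simp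
    show "AE y in hyperplane_lborel e. AE t in lborel. y + t *\<^sub>R e \<notin> Z"
      using AE_N AE_perp
    proof eventually_elim
      case (elim y)
      then have "y + t *\<^sub>R e \<notin> Z" for t by (simp add: Z_def inner_add_left ee)
      then show ?case by simp
    qed
  qed
  ultimately have "AE x in lborel. x \<notin> S \<and> x \<notin> Z" by eventually_elim blast
  then have "AE x in lborel. x \<in> \<Omega> \<longrightarrow> (\<lambda>t. g (x + t *\<^sub>R e)) field_differentiable (at 0)"
  proof eventually_elim
    case (elim x)
    show ?case
    proof
      assume x: "x \<in> \<Omega>"
      define y where "y = x - (x \<bullet> e) *\<^sub>R e"
      define t where "t = x \<bullet> e"
      have xy: "x = y + t *\<^sub>R e" by (simp add: y_def t_def)
      have good: "good y" using elim by (intro goodN) (simp add: Z_def y_def)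
      have t: "t \<in> {t. y + t *\<^sub>R e \<in> \<Omega>}" using x xy by simp
      obtain d where d: "d > 0" "cball t d \<subseteq> {t. y + t *\<^sub>R e \<in> \<Omega>}"
        using open_line t open_contains_cball by blast
      then have sub: "{t - d..t + d} \<subseteq> {t. y + t *\<^sub>R e \<in> \<Omega>}" by (simp add: cball_eq_atLeastAtMost)
      then have "abs_continuous_on (t - d) (t + d) (\<lambda>t. g (y + t *\<^sub>R e))"
        using good d(1) unfolding good_def by (auto simp: subset_iff)
      from abs_continuous_on_imp_continuous_on[OF this]
      have "continuous_on {- d<..<d} (\<lambda>s. g (y + (t + s) *\<^sub>R e))"
        by (rule continuous_on_compose2) (auto intro!: continuous_intros)
      moreover have "g (y + (t + s) *\<^sub>R e) = G (x + s *\<^sub>R e)" if "s \<in> {- d<..<d}" for s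
      proof -
        have "t + s \<in> {t - d..t + d}" using that by auto
        then have "y + (t + s) *\<^sub>R e \<in> \<Omega>" using sub by blast
        then show ?thesis by (simp add: G xy scaleR_left_distrib add_ac)
      qed
      ultimately have "continuous_on {- d<..<d} (\<lambda>s. G (x + s *\<^sub>R e))"
        by (rule continuous_on_eq)
      moreover have "rational_quotients_Cauchy (\<lambda>s. G (x + s *\<^sub>R e))" using elim x by (simp add: S_def)
      ultimately have "(\<lambda>s. G (x + s *\<^sub>R e)) field_differentiable (at 0)"
        using d(1) rational_quotients_Cauchy_imp_field_differentiable by blast
      then show "(\<lambda>s. g (x + s *\<^sub>R e)) field_differentiable (at 0)"
        using field_differentiable_cong_ev[OF line_eq[of y t]] t xy by simp
    qed
  qed
  then show ?thesis by (rule AE_completion)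
qed

section \<open>The comparison of Stein operators\<close>

lemma hs_inner_eq_sum: "hs_inner A B = (\<Sum>j\<in>UNIV. \<Sum>i\<in>UNIV. A $ i $ j * B $ i $ j)"
  by (simp add: hs_inner_def trace_def matrix_matrix_mult_def transpose_def)

text \<open>This is the product rule with \<open>F $ i $ j * p\<close> kept as a single factor,
  because only this product, not \<open>F\<close> or \<open>p\<close> alone, is known to be
  differentiable. The transpose in \<open>div_term\<close> turns its divergence into the row
  divergences of \<open>p F\<close> that \<open>T_div\<close> contains.\<close>

lemma div_term_eq_stein_op:
  assumes F: "\<And>i j. pderiv_exists j (\<lambda>y. F y $ i $ j * p y) x"
    and g: "\<And>i j. pderiv_exists j (\<lambda>y. grad g y $ i) x"
    and p: "p x \<noteq> 0"
  shows "div_term p F g x = stein_op p F g x * p x"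
proof -
  define A where "A i j = partial j (\<lambda>y. F y $ i $ j * p y) x" for i j
  have dF: "((\<lambda>t. F (x + t *\<^sub>R axis j 1) $ i $ j * p (x + t *\<^sub>R axis j 1)) has_field_derivative A i j) (at 0)" for i j
    using F[of j i] unfolding pderiv_exists_def A_def partial_def dir_deriv_def
    by (rule field_differentiable_derivI)
  have dg: "((\<lambda>t. grad g (x + t *\<^sub>R axis j 1) $ i) has_field_derivative hess g x $ i $ j) (at 0)" for i j
    using g[of j i] field_differentiable_derivI unfolding pderiv_exists_def
    by (fastforce simp: hess_def grad_def partial_def dir_deriv_def)
  have "partial j (\<lambda>y. (p y *\<^sub>R (transpose (F y) *v grad g y)) $ j) x
      = (\<Sum>i\<in>UNIV. A i j * grad g x $ i + hess g x $ i $ j * (F x $ i $ j * p x))" for j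
    unfolding partial_def dir_deriv_def
  proof (rule DERIV_imp_deriv)
    have "((\<lambda>t. \<Sum>i\<in>UNIV. (F (x + t *\<^sub>R axis j 1) $ i $ j * p (x + t *\<^sub>R axis j 1)) * grad g (x + t *\<^sub>R axis j 1) $ i)
      has_field_derivative (\<Sum>i\<in>UNIV. A i j * grad g (x + 0 *\<^sub>R axis j 1) $ i
        + hess g x $ i $ j * (F (x + 0 *\<^sub>R axis j 1) $ i $ j * p (x + 0 *\<^sub>R axis j 1)))) (at 0)"
      by (intro DERIV_sum DERIV_mult dF dg)
    then show "((\<lambda>t. (p (x + t *\<^sub>R axis j 1) *\<^sub>R (transpose (F (x + t *\<^sub>R axis j 1)) *v grad g (x + t *\<^sub>R axis j 1))) $ j)
      has_field_derivative (\<Sum>i\<in>UNIV. A i j * grad g x $ i + hess g x $ i $ j * (F x $ i $ j * p x))) (at 0)"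
      by (simp add: matrix_vector_mult_def transpose_def sum_distrib_left mult_ac)
  qed
  then have "div_term p F g x
      = (\<Sum>j\<in>UNIV. \<Sum>i\<in>UNIV. A i j * grad g x $ i + hess g x $ i $ j * (F x $ i $ j * p x))"
    by (simp add: div_term_def div_vec_def)
  also have "\<dots> = (\<Sum>j\<in>UNIV. \<Sum>i\<in>UNIV. A i j * grad g x $ i) + hs_inner (F x) (hess g x) * p x"
    by (simp add: hs_inner_eq_sum sum.distrib sum_distrib_left mult_ac)
  also have "(\<Sum>j\<in>UNIV. \<Sum>i\<in>UNIV. A i j * grad g x $ i) = (T_div p F x \<bullet> grad g x) * p x"
  proof -
    have "T_div p F x $ i * p x = (\<Sum>j\<in>UNIV. A i j)" for i
      using p by (simp add: T_div_def div_mat_def div_vec_def A_def mult.commute)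
    then have "(\<Sum>i\<in>UNIV. T_div p F x $ i * p x * grad g x $ i) = (\<Sum>i\<in>UNIV. \<Sum>j\<in>UNIV. A i j * grad g x $ i)"
      by (simp add: sum_distrib_right)
    also have "\<dots> = (\<Sum>j\<in>UNIV. \<Sum>i\<in>UNIV. A i j * grad g x $ i)" by (rule sum.swap)
    finally show ?thesis by (simp add: inner_vec_def sum_distrib_left mult_ac)
  qed
  finally show ?thesis by (simp add: stein_op_def algebra_simps)
qed

lemma ACL_AE_pderiv_exists:
  fixes g :: "real^'n \<Rightarrow> real"
  assumes "g \<in> ACL \<Omega>" "open \<Omega>"
  shows "AE x in lebesgue. x \<in> \<Omega> \<longrightarrow> pderiv_exists j g x"
  unfolding pderiv_exists_def by (rule ACL_AE_differentiable[OF assms]) simp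

text \<open>Two domains occur because, in the application, \<open>p\<close> is the second density
  while the gradient is known to be \<open>ACL\<close> on the larger support of the first. Finitely
  many index pairs give one common null set.\<close>

lemma AE_div_term_eq_stein_op:
  fixes F :: "real^'n \<Rightarrow> real^'n^'n"
  assumes F: "F \<in> Floc p" and "open (supp p)"
    and g: "\<And>i. (\<lambda>x. grad g x $ i) \<in> ACL \<Omega>" and \<Omega>: "open \<Omega>" "supp p \<subseteq> \<Omega>"
  shows "AE x in lebesgue. x \<in> supp p \<longrightarrow> div_term p F g x = stein_op p F g x * p x"
proof -
  have "AE x in lebesgue. \<forall>i j. x \<in> supp p \<longrightarrow> pderiv_exists j (\<lambda>y. F y $ i $ j * p y) x"
    using F \<open>open (supp p)\<close> unfolding Floc_def
    by (intro AE_all_countable[THEN iffD2] allI ACL_AE_pderiv_exists) auto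
  moreover have "AE x in lebesgue. \<forall>i j. x \<in> \<Omega> \<longrightarrow> pderiv_exists j (\<lambda>y. grad g y $ i) x"
    using g \<Omega>(1) by (intro AE_all_countable[THEN iffD2] allI ACL_AE_pderiv_exists) auto
  ultimately show ?thesis
  proof eventually_elim
    case (elim x)
    then show ?case using \<Omega>(2) by (auto intro!: div_term_eq_stein_op simp: supp_def)
  qed
qed

text \<open>Bridges the integrals against \<open>P\<close> in the Wasserstein distance and the
  Lebesgue integrals in \<open>expect\<close>. As \<open>h\<close> is arbitrary outside
  \<open>\<Omega>\<close>, only its product with the indicator is measurable; points of
  \<open>\<Omega>\<close> outside \<open>supp p\<close> contribute nothing because \<open>p\<close>
  vanishes there.\<close>

lemma has_pdf_set_integral:
  fixes h :: "real^'n \<Rightarrow> real"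
  assumes pdf: "has_pdf P p" and h: "continuous_on \<Omega> h" and \<Omega>: "open \<Omega>" "supp p \<subseteq> \<Omega>"
  shows "(LINT x:\<Omega>|P. h x) = expect p h"
proof -
  have p: "p \<in> borel_measurable borel" "\<And>x. 0 \<le> p x" "P = density lborel (\<lambda>x. ennreal (p x))"
    using pdf by (auto simp: has_pdf_def)
  have hm: "(\<lambda>x. indicator \<Omega> x *\<^sub>R h x) \<in> borel_measurable borel"
    using borel_measurable_continuous_on_restrict[OF h] \<Omega>
    by (simp add: borel_measurable_restrict_space_iff)
  have "(LINT x:\<Omega>|P. h x) = (LINT x|lborel. p x *\<^sub>R (indicator \<Omega> x *\<^sub>R h x))"
    unfolding set_lebesgue_integral_def p(3) using p hm by (intro integral_density) auto
  also have "\<dots> = (LINT x|lborel. indicator (supp p) x *\<^sub>R (h x * p x))"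
  proof (rule Bochner_Integration.integral_cong[OF refl])
    fix x
    show "p x *\<^sub>R (indicator \<Omega> x *\<^sub>R h x) = indicator (supp p) x *\<^sub>R (h x * p x)"
      using p(2)[of x] \<Omega>(2) by (cases "x \<in> supp p") (auto simp: supp_def indicator_def)
  qed
  also have "\<dots> = (LINT x|lebesgue. indicator (supp p) x *\<^sub>R (h x * p x))"
  proof (rule integral_completion[symmetric])
    have "(\<lambda>x. indicator (supp p) x *\<^sub>R (h x * p x)) = (\<lambda>x. p x *\<^sub>R (indicator \<Omega> x *\<^sub>R h x))"
    proof
      fix x
      show "indicator (supp p) x *\<^sub>R (h x * p x) = p x *\<^sub>R (indicator \<Omega> x *\<^sub>R h x)"
        using p(2)[of x] \<Omega>(2) by (cases "x \<in> supp p") (auto simp: supp_def indicator_def)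
    qed
    then show "(\<lambda>x. indicator (supp p) x *\<^sub>R (h x * p x)) \<in> borel_measurable lborel"
      using p(1) hm by simp
  qed
  finally show ?thesis by (simp add: expect_def set_lebesgue_integral_def)
qed

text \<open>The total mass is one. In the comparison the constant is \<open>expect p1 h\<close>,
  integrated against the other density.\<close>

lemma has_pdf_const:
  fixes p :: "real^'n \<Rightarrow> real"
  assumes "prob_space P" and pdf: "has_pdf P p"
  shows "(\<lambda>x. c) \<in> L1 p" "expect p (\<lambda>x. c) = c"
proof -
  interpret prob_space P by fact
  have p: "p \<in> borel_measurable borel" "\<And>x. 0 \<le> p x" "P = density lborel (\<lambda>x. ennreal (p x))"
    using pdf by (auto simp: has_pdf_def)
  have "expect p (\<lambda>x. c) = (LINT x:UNIV|P. c)"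
    using has_pdf_set_integral[OF pdf, of UNIV "\<lambda>x. c"] by simp
  also have "\<dots> = c" using prob_space p(3) by (simp add: set_lebesgue_integral_def)
  finally show "expect p (\<lambda>x. c) = c" .
  have "integrable P (\<lambda>x. c)" by simp
  then have int: "integrable lborel (\<lambda>x. p x *\<^sub>R c)"
    unfolding p(3) using p(1,2) by (subst (asm) integrable_density) auto
  have "p x *\<^sub>R c = indicator (supp p) x *\<^sub>R (c * p x)" for x
    using p(2)[of x] by (cases "x \<in> supp p") (auto simp: supp_def)
  then have "integrable lborel (\<lambda>x. indicator (supp p) x *\<^sub>R (c * p x))"
    using int by (simp only:)
  then have "integrable lebesgue (\<lambda>x. indicator (supp p) x *\<^sub>R (c * p x))"
    by (subst integrable_completion) (auto dest: borel_measurable_integrable)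
  then show "(\<lambda>x. c) \<in> L1 p" by (simp add: L1_def set_integrable_def)
qed

lemma expect_diff:
  assumes "f \<in> L1 p" "g \<in> L1 p"
  shows "expect p (\<lambda>x. f x - g x) = expect p f - expect p g"
  using assms set_integral_diff(2)[of lebesgue "supp p" "\<lambda>x. f x * p x" "\<lambda>x. g x * p x"]
  by (simp add: expect_def L1_def left_diff_distrib)

theorem theorem5p1:
  fixes P1 P2 :: "(real^'n) measure"
    and p1 p2 :: "real^'n \<Rightarrow> real"
    and F1 F2 :: "real^'n \<Rightarrow> real^'n^'n"
    and G2 :: "(real^'n \<Rightarrow> real) set"
  assumes "prob_space P1" and "prob_space P2"
    and "has_pdf P1 p1" and "has_pdf P2 p2"
    and "supp p2 \<subseteq> supp p1"
    and "\<And>h. h \<in> Lip1 (supp p1) \<Longrightarrow> h \<in> L1 p1"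
    and "F1 \<in> Floc p1" and "F2 \<in> Floc p2"
    and "G2 \<subseteq> stein_class p1 F1"
    and "\<And>g. g \<in> G2 \<Longrightarrow> stein_op p1 F1 g \<in> L1 p2"
    and "\<And>g. g \<in> G2 \<Longrightarrow> stein_op p2 F2 g \<in> L1 p2"
    and "\<And>g. g \<in> G2 \<Longrightarrow> set_integrable lebesgue (supp p2) (div_term p2 F2 g)"
    and "\<And>h. h \<in> Lip1 (supp p1) \<Longrightarrow>
           \<exists>g\<in>G2. AE x in lebesgue. x \<in> supp p1 \<longrightarrow> stein_op p1 F1 g x = h x - expect p1 h"
  shows "wasserstein1 (supp p1) P1 P2 \<le>
    (SUP g\<in>G2. ennreal \<bar>expect p2 (\<lambda>x. (T_div p1 F1 x - T_div p2 F2 x) \<bullet> grad g x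
                                        + hs_inner (F1 x - F2 x) (hess g x))\<bar>)
    + kappa2 p2 F2 G2"
  unfolding wasserstein1_def
proof (rule SUP_least)
  note prob2 = \<open>prob_space P2\<close> and pdf1 = \<open>has_pdf P1 p1\<close> and pdf2 = \<open>has_pdf P2 p2\<close>
    and sub = \<open>supp p2 \<subseteq> supp p1\<close>
  have open1: "open (supp p1)" and open2: "open (supp p2)"
    using pdf1 pdf2 by (auto simp: has_pdf_def)
  fix h assume h: "h \<in> Lip1 (supp p1)"
  then have cont: "continuous_on (supp p1) h"
    by (auto simp: Lip1_def intro: lipschitz_on_continuous_on)
  define c where "c = expect p1 h"
  obtain g where g: "g \<in> G2"
    and stein: "AE x in lebesgue. x \<in> supp p1 \<longrightarrow> stein_op p1 F1 g x = h x - c"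
    unfolding c_def using assms(13)[OF h] by blast
  let ?D = "\<lambda>x. (T_div p1 F1 x - T_div p2 F2 x) \<bullet> grad g x + hs_inner (F1 x - F2 x) (hess g x)"
  have A1: "stein_op p1 F1 g \<in> L1 p2" and A2: "stein_op p2 F2 g \<in> L1 p2"
    and dv: "set_integrable lebesgue (supp p2) (div_term p2 F2 g)"
    using assms(10-12) g by auto
  note const = has_pdf_const[OF prob2 pdf2, of "c"]
  \<comment> \<open>Integrability of \<open>h\<close> is given against \<open>p1\<close>. On
    \<open>supp p2\<close> it agrees almost everywhere with \<open>stein_op p1 F1 g + c\<close>,
    whose integrability against \<open>p2\<close> supplies the linearity used below.\<close>
  have sum_L1: "(\<lambda>x. stein_op p1 F1 g x + c) \<in> L1 p2"
    using set_integral_add(1)[of lebesgue "supp p2" "\<lambda>x. stein_op p1 F1 g x * p2 x" "\<lambda>x. c * p2 x"]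
      A1 const(1) by (simp add: L1_def distrib_right)
  have hp2: "(\<lambda>x. indicator (supp p2) x *\<^sub>R (h x * p2 x)) \<in> borel_measurable lebesgue"
  proof -
    have "(\<lambda>x. indicator (supp p2) x *\<^sub>R h x) \<in> borel_measurable borel"
      using borel_measurable_continuous_on_restrict[OF continuous_on_subset[OF cont sub]] open2
      by (simp add: borel_measurable_restrict_space_iff)
    moreover have "p2 \<in> borel_measurable borel" using pdf2 by (simp add: has_pdf_def)
    ultimately have "(\<lambda>x. (indicator (supp p2) x *\<^sub>R h x) * p2 x) \<in> borel_measurable borel" by measurable
    then show ?thesis by (simp add: mult.assoc measurable_completion)
  qed
  have "expect p2 h = expect p2 (\<lambda>x. stein_op p1 F1 g x + c)"
    unfolding expect_def set_lebesgue_integral_def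
  proof (rule integral_cong_AE[OF hp2])
    show "(\<lambda>x. indicator (supp p2) x *\<^sub>R ((stein_op p1 F1 g x + c) * p2 x)) \<in> borel_measurable lebesgue"
      using sum_L1 by (simp add: L1_def set_integrable_def)
    show "AE x in lebesgue. indicator (supp p2) x *\<^sub>R (h x * p2 x)
        = indicator (supp p2) x *\<^sub>R ((stein_op p1 F1 g x + c) * p2 x)"
      using stein by eventually_elim (use sub in \<open>auto simp: indicator_def\<close>)
  qed
  then have E1: "expect p2 (stein_op p1 F1 g) = expect p2 h - c"
    using expect_diff[OF sum_L1 const(1)] const(2) by simp
  have "(\<lambda>x. grad g x $ i) \<in> ACL (supp p1)" for i
    using assms(9) g by (auto simp: stein_class_def stein_dom_def)
  note ae = AE_div_term_eq_stein_op[OF \<open>F2 \<in> Floc p2\<close> open2 this open1 sub]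
  \<comment> \<open>No integration by parts takes place here: the integral of the divergence is kept
    as the boundary term bounded by \<open>kappa2\<close>.\<close>
  have E2: "expect p2 (stein_op p2 F2 g) = (LINT x:supp p2|lebesgue. div_term p2 F2 g x)"
    unfolding expect_def set_lebesgue_integral_def
  proof (rule integral_cong_AE)
    show "(\<lambda>x. indicator (supp p2) x *\<^sub>R (stein_op p2 F2 g x * p2 x)) \<in> borel_measurable lebesgue"
      using A2 by (simp add: L1_def set_integrable_def)
    show "(\<lambda>x. indicator (supp p2) x *\<^sub>R div_term p2 F2 g x) \<in> borel_measurable lebesgue"
      using dv by (simp add: set_integrable_def)
    show "AE x in lebesgue. indicator (supp p2) x *\<^sub>R (stein_op p2 F2 g x * p2 x)
        = indicator (supp p2) x *\<^sub>R div_term p2 F2 g x"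
      using ae by eventually_elim (auto simp: indicator_def)
  qed
  have "hs_inner (F1 x - F2 x) H = hs_inner (F1 x) H - hs_inner (F2 x) H" for x H
    by (simp add: hs_inner_eq_sum sum_subtractf left_diff_distrib)
  then have "?D x = stein_op p1 F1 g x - stein_op p2 F2 g x" for x
    by (simp only: stein_op_def inner_diff_left)
  then have "expect p2 ?D = expect p2 (\<lambda>x. stein_op p1 F1 g x - stein_op p2 F2 g x)"
    by (simp only:)
  then have E3: "expect p2 ?D = expect p2 (stein_op p1 F1 g) - expect p2 (stein_op p2 F2 g)"
    using expect_diff[OF A1 A2] by simp
  \<comment> \<open>By \<open>E1\<close>, \<open>E2\<close> and \<open>E3\<close> the difference is
    minus the sum on the right; the absolute value absorbs the sign.\<close>
  have "\<bar>(LINT x:supp p1|P1. h x) - (LINT x:supp p1|P2. h x)\<bar>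
      = \<bar>expect p2 ?D + (LINT x:supp p2|lebesgue. div_term p2 F2 g x)\<bar>"
    using E1 E2 E3 c_def has_pdf_set_integral[OF pdf1 cont open1 order_refl]
      has_pdf_set_integral[OF pdf2 cont open1 sub] by simp
  also have "\<dots> \<le> \<bar>expect p2 ?D\<bar> + \<bar>LINT x:supp p2|lebesgue. div_term p2 F2 g x\<bar>"
    by (rule abs_triangle_ineq)
  \<comment> \<open>The triangle inequality is proved for real integrals and only then moved to
    \<open>ennreal\<close>, where the suprema exist even when infinite.\<close>
  finally have "ennreal \<bar>(LINT x:supp p1|P1. h x) - (LINT x:supp p1|P2. h x)\<bar>
      \<le> ennreal \<bar>expect p2 ?D\<bar> + ennreal \<bar>LINT x:supp p2|lebesgue. div_term p2 F2 g x\<bar>"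
    by (simp add: ennreal_leI flip: ennreal_plus)
  also have "\<dots> \<le> (SUP g\<in>G2. ennreal \<bar>expect p2 (\<lambda>x. (T_div p1 F1 x - T_div p2 F2 x) \<bullet> grad g x
                                        + hs_inner (F1 x - F2 x) (hess g x))\<bar>)
    + kappa2 p2 F2 G2"
    unfolding kappa2_def by (intro add_mono SUP_upper2[OF g] order_refl)
  finally show "ennreal \<bar>(LINT x:supp p1|P1. h x) - (LINT x:supp p1|P2. h x)\<bar>
    \<le> (SUP g\<in>G2. ennreal \<bar>expect p2 (\<lambda>x. (T_div p1 F1 x - T_div p2 F2 x) \<bullet> grad g x
                                        + hs_inner (F1 x - F2 x) (hess g x))\<bar>)
    + kappa2 p2 F2 G2" .
qed

end
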